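(* The problem MaxReach-PathTemporalization (MR-PT) is fixed-parameter tractable when parameterized by the number $k$ of given paths.
   Context: A temporal multigraph $\mathcal G=(V,E,\lambda)$ consists of a directed multigraph $(V,E)$ and a labeling $\lambda$ assigning integer time labels to edges; a pair $(e,t)$ with $t\in\lambda(e)$ is a temporal edge. A temporal path is a sequence of temporal edges $((e_1,t_1),\dots,(e_m,t_m))$ such that $e_1,\dots,e_m$ form a directed path (the head of $e_i$ is the tail of $e_{i+1}$) and $t_1<t_2<\dots<t_m$. A vertex $u$ reaches $v$ if there is a temporal path from $u$ to $v$; $R^{\mathcal G}(u)$ denotes the set of vertices reached by $u$. MR-PT: the input is a collection $\mathbb P$ of $k$ static directed paths (over a common vertex set) and a vertex $s$. The task is to find a labeling $\lambda$ that assigns to every edge of every path in $\mathbb P$ one integer label such that the labels along each path are strictly increasing, so that the number of vertices that $s$ can reach in the resulting temporal multigraph (the multiset union of the resulting temporal paths) is maximized. Fixed-parameter tractable means solvable (computing an optimal labeling) in time $f(k)\cdot \mathrm{poly}(n)$ for a computable $f$, where $n$ is the input size. *)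

theory Defs
  imports
    "Graph_Theory.Arc_Walk"
    "HOL-Computational_Algebra.Polynomial"
begin

section \<open>A machine model\<close>

text \<open>
  Programs are first-order, call-by-value functional programs over binary trees (the data domain
  of Lisp and of Jones' languages WHILE and F). Every evaluation step is charged the number of
  nodes of the tree it produces, so an evaluation of cost \<open>t\<close> only ever handles trees with at most
  \<open>t\<close> nodes. Hence this cost measure and the running time of Turing machines are polynomially
  related.
\<close>

datatype data = Leaf | Node data data

fun nodes :: "data \<Rightarrow> nat" where
  "nodes Leaf = 1"
| "nodes (Node a b) = 1 + nodes a + nodes b"

datatype expr =
    Var nat
  | LeafE
  | NodeE expr expr
  | Left expr
  | Right expr
  | Cond expr expr expr
  | Call nat "expr list"

text \<open>
  A program is the list of its function bodies; \<open>Call f es\<close> invokes the body at index \<open>f\<close>, in which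
  \<open>Var i\<close> is the argument at index \<open>i\<close>.
\<close>

type_synonym program = "expr list"

inductive
  eval :: "program \<Rightarrow> data list \<Rightarrow> expr \<Rightarrow> data \<Rightarrow> nat \<Rightarrow> bool" and
  evals :: "program \<Rightarrow> data list \<Rightarrow> expr list \<Rightarrow> data list \<Rightarrow> nat \<Rightarrow> bool"
  for P :: program
where
  Var: "i < length env \<Longrightarrow> eval P env (Var i) (env ! i) (nodes (env ! i))"
| LeafE: "eval P env LeafE Leaf 1"
| NodeE: "eval P env a x s \<Longrightarrow> eval P env b y t \<Longrightarrow>
    eval P env (NodeE a b) (Node x y) (s + t + nodes (Node x y))"
| Left_Leaf: "eval P env a Leaf t \<Longrightarrow> eval P env (Left a) Leaf (t + 1)"
| Left_Node: "eval P env a (Node x y) t \<Longrightarrow> eval P env (Left a) x (t + nodes x)"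
| Right_Leaf: "eval P env a Leaf t \<Longrightarrow> eval P env (Right a) Leaf (t + 1)"
| Right_Node: "eval P env a (Node x y) t \<Longrightarrow> eval P env (Right a) y (t + nodes y)"
| Cond_Node: "eval P env c (Node x y) s \<Longrightarrow> eval P env a v t \<Longrightarrow>
    eval P env (Cond c a b) v (s + t + nodes v)"
| Cond_Leaf: "eval P env c Leaf s \<Longrightarrow> eval P env b v t \<Longrightarrow>
    eval P env (Cond c a b) v (s + t + nodes v)"
| Call: "f < length P \<Longrightarrow> evals P env es vs s \<Longrightarrow> eval P vs (P ! f) v t \<Longrightarrow>
    eval P env (Call f es) v (s + t + nodes v)"
| Nil: "evals P env [] [] 0"
| Cons: "eval P env e v s \<Longrightarrow> evals P env es vs t \<Longrightarrow> evals P env (e # es) (v # vs) (s + t)"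

definition runs :: "program \<Rightarrow> data \<Rightarrow> data \<Rightarrow> nat \<Rightarrow> bool" where
  "runs P d v t \<longleftrightarrow> eval P [d] (Call 0 [Var 0]) v t"

inductive_cases eval_VarE: "eval P env (Var i) v t"
inductive_cases eval_LeafEE: "eval P env LeafE v t"
inductive_cases eval_NodeEE: "eval P env (NodeE a b) v t"
inductive_cases eval_LeftE: "eval P env (Left a) v t"
inductive_cases eval_RightE: "eval P env (Right a) v t"
inductive_cases eval_CondE: "eval P env (Cond c a b) v t"
inductive_cases eval_CallE: "eval P env (Call f es) v t"
inductive_cases evals_NilE: "evals P env [] vs t"
inductive_cases evals_ConsE: "evals P env (e # es) vs t"

lemma eval_deterministic:
  "eval P env e v t \<Longrightarrow> (\<And>v' t'. eval P env e v' t' \<Longrightarrow> v' = v \<and> t' = t)"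
  "evals P env es vs t \<Longrightarrow> (\<And>vs' t'. evals P env es vs' t' \<Longrightarrow> vs' = vs \<and> t' = t)"
proof (induction rule: eval_evals.inducts)
  case (Var i env) then show ?case by (auto elim: eval_VarE)
next
  case (LeafE env) then show ?case by (auto elim: eval_LeafEE)
next
  case (NodeE env a x s b y t)
  from NodeE.prems show ?case by (auto elim!: eval_NodeEE dest!: NodeE.IH(2,4))
next
  case (Left_Leaf env a t)
  from Left_Leaf.prems show ?case by (auto elim!: eval_LeftE dest!: Left_Leaf.IH(2))
next
  case (Left_Node env a x y t)
  from Left_Node.prems show ?case by (auto elim!: eval_LeftE dest!: Left_Node.IH(2))
next
  case (Right_Leaf env a t)
  from Right_Leaf.prems show ?case by (auto elim!: eval_RightE dest!: Right_Leaf.IH(2))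
next
  case (Right_Node env a x y t)
  from Right_Node.prems show ?case by (auto elim!: eval_RightE dest!: Right_Node.IH(2))
next
  case (Cond_Node env c x y s a v t b)
  from Cond_Node.prems show ?case by (auto elim!: eval_CondE dest!: Cond_Node.IH(2,4))
next
  case (Cond_Leaf env c s b v t a)
  from Cond_Leaf.prems show ?case by (auto elim!: eval_CondE dest!: Cond_Leaf.IH(2,4))
next
  case (Call f env es vs s v t)
  from Call.prems show ?case by (auto elim!: eval_CallE dest!: Call.IH(3,5))
next
  case (Nil env) then show ?case by (auto elim: evals_NilE)
next
  case (Cons env e v s es vs t)
  from Cons.prems show ?case by (auto elim!: evals_ConsE dest!: Cons.IH(2,4))
qed

lemma runs_deterministic: "runs P d v t \<Longrightarrow> runs P d v' t' \<Longrightarrow> v' = v \<and> t' = t"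
  unfolding runs_def by (rule eval_deterministic(1))

lemma nodes_le_cost: "eval P env e v t \<Longrightarrow> nodes v \<le> t"
  by (cases rule: eval.cases) auto

section \<open>Encodings\<close>

fun enc_bool :: "bool \<Rightarrow> data" where
  "enc_bool False = Leaf"
| "enc_bool True = Node Leaf Leaf"

text \<open>Numbers are encoded in binary, least significant bit first.\<close>

fun enc_nat :: "nat \<Rightarrow> data" where
  "enc_nat n = (if n = 0 then Leaf else Node (enc_bool (odd n)) (enc_nat (n div 2)))"

declare enc_nat.simps [simp del]

definition enc_int :: "int \<Rightarrow> data" where
  "enc_int z = Node (enc_bool (z < 0)) (enc_nat (nat \<bar>z\<bar>))"

fun enc_list :: "('a \<Rightarrow> data) \<Rightarrow> 'a list \<Rightarrow> data" where
  "enc_list enc [] = Leaf"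
| "enc_list enc (x # xs) = Node (enc x) (enc_list enc xs)"

lemma inj_enc_bool: "inj enc_bool"
proof (rule injI)
  fix a b show "enc_bool a = enc_bool b \<Longrightarrow> a = b" by (cases a; cases b) auto
qed

lemma inj_enc_nat: "inj enc_nat"
proof (rule injI)
  fix m n show "enc_nat m = enc_nat n \<Longrightarrow> m = n"
  proof (induction m arbitrary: n rule: less_induct)
    case (less m)
    show ?case
    proof (cases "m = 0 \<or> n = 0")
      case True
      then show ?thesis using less.prems by (auto simp: enc_nat.simps[of m] enc_nat.simps[of n]
            split: if_splits)
    next
      case False
      then have "enc_bool (odd m) = enc_bool (odd n)" and "enc_nat (m div 2) = enc_nat (n div 2)"
        using less.prems by (auto simp: enc_nat.simps[of m] enc_nat.simps[of n])
      then have "odd m = odd n" and "m div 2 = n div 2"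
        using less.IH[of "m div 2" "n div 2"] False injD[OF inj_enc_bool] by auto
      then show ?thesis by (metis div_mult_mod_eq odd_iff_mod_2_eq_one not_mod_2_eq_1_eq_0)
    qed
  qed
qed

lemma inj_enc_int: "inj enc_int"
proof (rule injI)
  fix x y assume "enc_int x = enc_int y"
  then have "(x < 0) = (y < 0)" and "nat \<bar>x\<bar> = nat \<bar>y\<bar>"
    using injD[OF inj_enc_bool] injD[OF inj_enc_nat] by (auto simp: enc_int_def)
  then show "x = y" by auto
qed

lemma inj_enc_list: assumes "inj enc" shows "inj (enc_list enc)"
proof (rule injI)
  fix xs ys show "enc_list enc xs = enc_list enc ys \<Longrightarrow> xs = ys"
  proof (induction xs arbitrary: ys)
    case Nil then show ?case by (cases ys) auto
  next
    case (Cons x xs) then show ?case using injD[OF assms] by (cases ys) auto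
  qed
qed

section \<open>Fixed-parameter tractability\<close>

definition computable :: "(nat \<Rightarrow> nat) \<Rightarrow> bool" where
  "computable f \<longleftrightarrow> (\<exists>P. \<forall>k. \<exists>t. runs P (enc_nat k) (enc_nat (f k)) t)"

text \<open>
  A parameterized search problem is given by its set \<open>I\<close> of instances, the parameter \<open>\<kappa>\<close>, the
  relation \<open>S\<close> between instances and their admissible answers, and the encodings of both.
\<close>

definition fixed_parameter_tractable ::
  "'i set \<Rightarrow> ('i \<Rightarrow> nat) \<Rightarrow> ('i \<Rightarrow> 'o \<Rightarrow> bool) \<Rightarrow> ('i \<Rightarrow> data) \<Rightarrow> ('o \<Rightarrow> data) \<Rightarrow> bool" where
  "fixed_parameter_tractable I \<kappa> S enc_in enc_out \<longleftrightarrow>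
    (\<exists>P f. \<exists>p :: nat poly. computable f \<and>
      (\<forall>x\<in>I. \<exists>y t. S x y \<and> runs P (enc_in x) (enc_out y) t \<and>
        t \<le> f (\<kappa> x) * poly p (nodes (enc_in x))))"

section \<open>Temporal multigraphs\<close>

record ('v, 'e) temporal_multigraph =
  underlying :: "('v, 'e) pre_digraph"
  labels :: "'e \<Rightarrow> int set"

definition temporal_path ::
  "('v, 'e) temporal_multigraph \<Rightarrow> 'v \<Rightarrow> ('e \<times> int) list \<Rightarrow> 'v \<Rightarrow> bool" where
  "temporal_path G u q v \<longleftrightarrow>
    pre_digraph.awalk (underlying G) u (map fst q) v \<and>
    (\<forall>(e, t) \<in> set q. t \<in> labels G e) \<and>
    sorted_wrt (<) (map snd q)"

definition reached :: "('v, 'e) temporal_multigraph \<Rightarrow> 'v \<Rightarrow> 'v set" where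
  "reached G u = {v. \<exists>q. temporal_path G u q v}"

section \<open>MaxReach-PathTemporalization\<close>

text \<open>
  Vertices are named by natural numbers, the vertex set is listed explicitly, and a path is given
  by the sequence of its vertices.
\<close>

record mrpt =
  vertices :: "nat list"
  paths :: "nat list list"
  source :: nat

definition mrpt_instances :: "mrpt set" where
  "mrpt_instances = {x. distinct (vertices x) \<and> source x \<in> set (vertices x) \<and>
    (\<forall>p\<in>set (paths x). p \<noteq> [] \<and> set p \<subseteq> set (vertices x))}"

text \<open>\<open>L ! i ! j\<close> is the label of the \<open>j\<close>-th edge of the \<open>i\<close>-th path.\<close>

definition path_labeling :: "mrpt \<Rightarrow> int list list \<Rightarrow> bool" where
  "path_labeling x L \<longleftrightarrow> length L = length (paths x) \<and>
    (\<forall>i < length (paths x). length (L ! i) + 1 = length (paths x ! i) \<and> sorted_wrt (<) (L ! i))"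

text \<open>
  The edge \<open>(i, j)\<close> is the \<open>j\<close>-th edge of the \<open>i\<close>-th path, so edges of different paths stay distinct
  even if they join the same vertices.
\<close>

definition temporalization :: "mrpt \<Rightarrow> int list list \<Rightarrow> (nat, nat \<times> nat) temporal_multigraph" where
  "temporalization x L =
    \<lparr>underlying =
      \<lparr>verts = set (vertices x),
       arcs = {(i, j). i < length (paths x) \<and> j + 1 < length (paths x ! i)},
       tail = (\<lambda>(i, j). paths x ! i ! j),
       head = (\<lambda>(i, j). paths x ! i ! (j + 1))\<rparr>,
     labels = (\<lambda>(i, j). {L ! i ! j})\<rparr>"

definition optimal_labeling :: "mrpt \<Rightarrow> int list list \<Rightarrow> bool" where
  "optimal_labeling x L \<longleftrightarrow> path_labeling x L \<and>
    (\<forall>L'. path_labeling x L' \<longrightarrow>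
      card (reached (temporalization x L') (source x))
        \<le> card (reached (temporalization x L) (source x)))"

definition enc_mrpt :: "mrpt \<Rightarrow> data" where
  "enc_mrpt x = Node (enc_nat (source x))
    (Node (enc_list enc_nat (vertices x)) (enc_list (enc_list enc_nat) (paths x)))"

lemma inj_enc_mrpt: "inj enc_mrpt"
  by (rule injI)
    (simp add: enc_mrpt_def inj_eq inj_enc_nat inj_enc_list)

lemma wf_temporalization:
  assumes "x \<in> mrpt_instances"
  shows "wf_digraph (underlying (temporalization x L))"
proof -
  have "paths x ! i ! j \<in> set (vertices x)" if "i < length (paths x)" "j < length (paths x ! i)" for i j
    using assms nth_mem[OF that(1)] nth_mem[OF that(2)] unfolding mrpt_instances_def by blast
  then show ?thesis by unfold_locales (auto simp: temporalization_def)
qed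

end

theory Submission
  imports Defs
begin

text \<open>
  Some optimal labeling serves the paths one after another: all labels of the first path precede
  all labels of the second one, and so on. Given any labeling, order the paths by the time at which
  they can first be boarded by a traveller starting at the source. Where path \<open>i\<close> is first boarded,
  the traveller arrives on a path that was boarded strictly earlier, so in the serial schedule each
  path is boarded at the same position or before, and everything after that position is reached.
  Hence it suffices to try all \<open>k!\<close> orders of the paths; for a fixed order the reached set is
  computed by one sweep over the paths.
\<close>

section \<open>Cost calculus for the machine model\<close>

text \<open>Most of the work is cost analysis: the algorithm has to be an actual program over trees,
  and its running time is bounded in that model. The model has no arithmetic and no local bindings,
  and this shapes the program: scores are compared as list lengths, labels grow by prepending bits,
  and a value used twice is computed twice. All orders are stored in one list, so the size bound
  \<open>N\<close> contains the factor \<open>k!\<close>; O(\<open>N^5\<close>) steps of charge at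
  most \<open>N\<close> give O(\<open>N^6\<close>). Numerical constants in the step counts are
  rounded up generously. Tractability also asks for a parameter function that is computable in the
  same model, and it has to absorb \<open>(k!)^6\<close>. Iterated exponentials serve for that:
  doubling a list once per element of another list is a much shorter program than multiplication.
  Optimality rests on two inclusions: a serial labeling reaches at least the vertices in
  \<open>rides\<close> of its order, and whatever an arbitrary labeling reaches lies in
  \<open>rides\<close> of some order.\<close>

text \<open>
  Sizes and step counts are bounded separately: \<open>N\<close> bounds the size of every tree that occurs,
  hence the charge of every single step, and \<open>c\<close> bounds the number of steps.
\<close>

definition ev :: "program \<Rightarrow> nat \<Rightarrow> data list \<Rightarrow> expr \<Rightarrow> data \<Rightarrow> nat \<Rightarrow> bool" where
  "ev P N env e v c \<longleftrightarrow> nodes v \<le> N \<and> (\<exists>t \<le> c * N. eval P env e v t)"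

text \<open>\<open>ev\<close> in continuation form. The rules below then apply backwards, guided by
  the syntax of the expression, and compute value and step count on the way; no existential witness
  has to be supplied.\<close>

definition wp :: "program \<Rightarrow> nat \<Rightarrow> data list \<Rightarrow> expr \<Rightarrow> (data \<Rightarrow> nat \<Rightarrow> bool) \<Rightarrow> bool" where
  "wp P N env e K \<longleftrightarrow> (\<exists>v c. ev P N env e v c \<and> K v c)"

definition wps ::
  "program \<Rightarrow> nat \<Rightarrow> data list \<Rightarrow> expr list \<Rightarrow> (data list \<Rightarrow> nat \<Rightarrow> bool) \<Rightarrow> bool" where
  "wps P N env es K \<longleftrightarrow> (\<exists>vs c. (\<exists>t \<le> c * N. evals P env es vs t) \<and> K vs c)"

text \<open>A separate constant for the callee: backward execution stops here until a specification
  of the called function is supplied through \<open>calls_wpc\<close>.\<close>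

definition wpc :: "program \<Rightarrow> nat \<Rightarrow> nat \<Rightarrow> data list \<Rightarrow> (data \<Rightarrow> nat \<Rightarrow> bool) \<Rightarrow> bool" where
  "wpc P N f vs K \<longleftrightarrow> wp P N vs (P ! f) K"

text \<open>Total projections that follow the machine convention for \<open>Leaf\<close>; they merge
  the two evaluation rules of \<open>Left\<close>, and of \<open>Right\<close>, into one
  \<open>wp\<close> rule each.\<close>

fun lft :: "data \<Rightarrow> data" where
  "lft Leaf = Leaf"
| "lft (Node a b) = a"

fun rgt :: "data \<Rightarrow> data" where
  "rgt Leaf = Leaf"
| "rgt (Node a b) = b"

lemma nodes_pos [simp]: "0 < nodes d" "Suc 0 \<le> nodes d" "nodes d \<noteq> 0"
  by (cases d; simp)+

lemma wp_Var: "i < length env \<Longrightarrow> nodes (env ! i) \<le> N \<Longrightarrow> K (env ! i) 1 \<Longrightarrow> wp P N env (Var i) K"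
  unfolding wp_def ev_def
  by (intro exI[of _ "env ! i"] exI[of _ 1] conjI exI[of _ "nodes (env ! i)"] eval_evals.Var) auto

lemma wp_LeafE: "0 < N \<Longrightarrow> K Leaf 1 \<Longrightarrow> wp P N env LeafE K"
  unfolding wp_def ev_def
  by (intro exI[of _ Leaf] exI[of _ 1] conjI eval_evals.LeafE) auto

lemma wp_NodeE:
  assumes "wp P N env a (\<lambda>x s. wp P N env b
    (\<lambda>y t. nodes (Node x y) \<le> N \<and> K (Node x y) (s + t + 1)))"
  shows "wp P N env (NodeE a b) K"
proof -
  obtain x y s t s' t' where
    a: "s' \<le> s * N" "eval P env a x s'" and b: "t' \<le> t * N" "eval P env b y t'" and
    n: "nodes (Node x y) \<le> N" and K: "K (Node x y) (s + t + 1)"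
    using assms unfolding wp_def ev_def by blast
  have "s' + t' + nodes (Node x y) \<le> (s + t + 1) * N"
    using a(1) b(1) n by (simp add: algebra_simps)
  then show ?thesis
    unfolding wp_def ev_def using eval_evals.NodeE[OF a(2) b(2)] n K by blast
qed

lemma wp_Left:
  assumes "wp P N env a (\<lambda>x s. K (lft x) (s + 1))"
  shows "wp P N env (Left a) K"
proof -
  obtain x s s' where a: "s' \<le> s * N" "eval P env a x s'" "nodes x \<le> N" and K: "K (lft x) (s + 1)"
    using assms unfolding wp_def ev_def by blast
  have n: "nodes (lft x) \<le> N" using a(3) by (cases x) auto
  have e: "eval P env (Left a) (lft x) (s' + nodes (lft x))"
    using a(2) eval_evals.Left_Leaf eval_evals.Left_Node by (cases x) auto
  have "s' + nodes (lft x) \<le> (s + 1) * N" using a(1) n by (simp add: algebra_simps)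
  then show ?thesis unfolding wp_def ev_def using e n K by blast
qed

lemma wp_Right:
  assumes "wp P N env a (\<lambda>x s. K (rgt x) (s + 1))"
  shows "wp P N env (Right a) K"
proof -
  obtain x s s' where a: "s' \<le> s * N" "eval P env a x s'" "nodes x \<le> N" and K: "K (rgt x) (s + 1)"
    using assms unfolding wp_def ev_def by blast
  have n: "nodes (rgt x) \<le> N" using a(3) by (cases x) auto
  have e: "eval P env (Right a) (rgt x) (s' + nodes (rgt x))"
    using a(2) eval_evals.Right_Leaf eval_evals.Right_Node by (cases x) auto
  have "s' + nodes (rgt x) \<le> (s + 1) * N" using a(1) n by (simp add: algebra_simps)
  then show ?thesis unfolding wp_def ev_def using e n K by blast
qed

lemma wp_Cond:
  assumes "wp P N env c (\<lambda>x s. if x = Leaf then wp P N env b (\<lambda>v t. K v (s + t + 1))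
    else wp P N env a (\<lambda>v t. K v (s + t + 1)))"
  shows "wp P N env (Cond c a b) K"
proof -
  obtain x s s' where c: "s' \<le> s * N" "eval P env c x s'" and
    K: "if x = Leaf then wp P N env b (\<lambda>v t. K v (s + t + 1))
      else wp P N env a (\<lambda>v t. K v (s + t + 1))"
    using assms unfolding wp_def ev_def by blast
  have "\<exists>v t. K v (s + t + 1) \<and> nodes v \<le> N \<and>
      (\<exists>t' \<le> t * N. eval P env (Cond c a b) v (s' + t' + nodes v))"
  proof (cases x)
    case Leaf
    then show ?thesis using K c(2) eval_evals.Cond_Leaf unfolding wp_def ev_def by simp blast
  next
    case (Node y z)
    then show ?thesis using K c(2) eval_evals.Cond_Node unfolding wp_def ev_def by simp blast
  qed
  then obtain v t t' where v: "K v (s + t + 1)" "nodes v \<le> N" "t' \<le> t * N"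
    "eval P env (Cond c a b) v (s' + t' + nodes v)" by blast
  have "s' + t' + nodes v \<le> (s + t + 1) * N" using c(1) v(2,3) by (simp add: algebra_simps)
  then show ?thesis unfolding wp_def ev_def using v by blast
qed

lemma wp_Call:
  assumes "f < length P" and "wps P N env es (\<lambda>vs s. wpc P N f vs (\<lambda>v c. K v (s + c + 1)))"
  shows "wp P N env (Call f es) K"
proof -
  obtain vs s s' v c c' where es: "s' \<le> s * N" "evals P env es vs s'" and
    v: "nodes v \<le> N" "c' \<le> c * N" "eval P vs (P ! f) v c'" and K: "K v (s + c + 1)"
    using assms(2) unfolding wpc_def wps_def wp_def ev_def by blast
  have "s' + c' + nodes v \<le> (s + c + 1) * N" using es(1) v(1,2) by (simp add: algebra_simps)
  then show ?thesis
    unfolding wp_def ev_def using eval_evals.Call[OF assms(1) es(2) v(3)] v(1) K by blast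
qed

lemma wps_Nil: "K [] 0 \<Longrightarrow> wps P N env [] K"
  unfolding wps_def using eval_evals.Nil[of P env] by force

lemma wps_Cons:
  assumes "wp P N env e (\<lambda>v s. wps P N env es (\<lambda>vs t. K (v # vs) (s + t)))"
  shows "wps P N env (e # es) K"
proof -
  obtain v s s' vs t t' where e: "s' \<le> s * N" "eval P env e v s'" and
    es: "t' \<le> t * N" "evals P env es vs t'" and K: "K (v # vs) (s + t)"
    using assms unfolding wps_def wp_def ev_def by blast
  have "s' + t' \<le> (s + t) * N" using e(1) es(1) by (simp add: algebra_simps)
  then show ?thesis unfolding wps_def using eval_evals.Cons[OF e(2) es(2)] K by blast
qed

lemmas wp_intros = wp_Var wp_LeafE wp_NodeE wp_Left wp_Right wp_Cond wp_Call wps_Nil wps_Cons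

definition calls :: "program \<Rightarrow> nat \<Rightarrow> nat \<Rightarrow> data list \<Rightarrow> data \<Rightarrow> nat \<Rightarrow> bool" where
  "calls P N f vs v c \<longleftrightarrow> wpc P N f vs (\<lambda>v' c'. v' = v \<and> c' \<le> c)"

lemma callsI: "P ! f = b \<Longrightarrow> wp P N vs b (\<lambda>v' c'. v' = v \<and> c' \<le> c) \<Longrightarrow> calls P N f vs v c"
  by (simp add: calls_def wpc_def)

text \<open>The budget in \<open>ev\<close> is only an upper bound, so an evaluation within
  \<open>c' \<le> c\<close> steps also counts as one with \<open>c\<close> steps. Hence the
  continuation has to hold at the single value \<open>c\<close> only.\<close>

lemma calls_wpc:
  assumes "calls P N f vs v c" "K v c"
  shows "wpc P N f vs K"
proof -
  obtain c' t where "c' \<le> c" "nodes v \<le> N" "t \<le> c' * N" "eval P vs (P ! f) v t"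
    using assms(1) unfolding calls_def wpc_def wp_def ev_def by blast
  moreover have "c' * N \<le> c * N" using \<open>c' \<le> c\<close> by simp
  ultimately show ?thesis using assms(2) unfolding wpc_def wp_def ev_def by (meson le_trans)
qed

lemma calls_mono: "calls P N f vs v c \<Longrightarrow> c \<le> c' \<Longrightarrow> calls P N f vs v c'"
  unfolding calls_def by (rule calls_wpc[unfolded calls_def]) auto

section \<open>The program\<close>

abbreviation TrueE :: expr where "TrueE \<equiv> NodeE LeafE LeafE"

text \<open>\<open>Call n\<close> below refers to the position \<open>n\<close> of a body in \<open>prog\<close>.\<close>

abbreviation "append_body \<equiv>
  Cond (Var 0) (NodeE (Left (Var 0)) (Call 1 [Right (Var 0), Var 1])) (Var 1)"

abbreviation "eq_body \<equiv>
  Cond (Var 0)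
    (Cond (Var 1)
      (Cond (Call 2 [Left (Var 0), Left (Var 1)]) (Call 2 [Right (Var 0), Right (Var 1)]) LeafE)
      LeafE)
    (Cond (Var 1) LeafE TrueE)"

abbreviation "member_body \<equiv>
  Cond (Var 1) (Cond (Call 2 [Var 0, Left (Var 1)]) TrueE (Call 3 [Var 0, Right (Var 1)])) LeafE"

abbreviation "map_cons_body \<equiv>
  Cond (Var 1) (NodeE (NodeE (Var 0) (Left (Var 1))) (Call 4 [Var 0, Right (Var 1)])) LeafE"

abbreviation "insert_all_body \<equiv>
  Cond (Var 1)
    (NodeE (NodeE (Var 0) (Var 1)) (Call 4 [Left (Var 1), Call 5 [Var 0, Right (Var 1)]]))
    (NodeE (NodeE (Var 0) LeafE) LeafE)"

abbreviation "concat_insert_all_body \<equiv>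
  Cond (Var 1) (Call 1 [Call 5 [Var 0, Left (Var 1)], Call 6 [Var 0, Right (Var 1)]]) LeafE"

text \<open>Here \<open>TrueE\<close> stands for \<open>[[]]\<close>, the list with one empty
  schedule: \<open>Leaf\<close> encodes \<open>False\<close>, \<open>0\<close> and the empty list
  alike.\<close>

abbreviation "schedules_body \<equiv> Cond (Var 0) (Call 6 [Var 0, Call 7 [Right (Var 0)]]) TrueE"

abbreviation "ride_body \<equiv>
  Cond (Var 1) (Cond (Call 3 [Left (Var 1), Var 0]) (Var 1) (Call 8 [Var 0, Right (Var 1)])) LeafE"

abbreviation "rides_body \<equiv>
  Cond (Var 1)
    (Call 9 [Call 1 [Call 8 [Var 0, Left (Left (Var 1))], Var 0], Right (Var 1)])
    (Var 0)"

abbreviation "filter_body \<equiv>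
  Cond (Var 1)
    (Cond (Call 3 [Left (Var 1), Var 0])
      (NodeE (Left (Var 1)) (Call 10 [Var 0, Right (Var 1)]))
      (Call 10 [Var 0, Right (Var 1)]))
    LeafE"

text \<open>Strips both lists in parallel, which compares scores without any arithmetic.\<close>

abbreviation "longer_body \<equiv>
  Cond (Var 1) (Cond (Var 0) (Call 11 [Right (Var 0), Right (Var 1)]) LeafE) TrueE"

abbreviation "best_body \<equiv>
  Cond (Var 3)
    (Cond (Call 11 [Call 10 [Call 9 [Var 0, Var 2], Var 1],
                    Call 10 [Call 9 [Var 0, Left (Var 3)], Var 1]])
      (Call 12 [Var 0, Var 1, Var 2, Right (Var 3)])
      (Call 12 [Var 0, Var 1, Left (Var 3), Right (Var 3)]))
    (Var 2)"

text \<open>\<open>NodeE LeafE (Var 1)\<close> occurs in two roles: with \<open>Leaf\<close> as sign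
  it is the integer \<open>t\<close>, with \<open>Leaf\<close> as lowest bit it is the number
  \<open>2 * t\<close>. The test on \<open>Right (Var 0)\<close> asks whether an edge is
  left.\<close>

abbreviation "block_body \<equiv>
  Cond (Right (Var 0))
    (NodeE (NodeE LeafE (Var 1)) (Call 13 [Right (Var 0), NodeE LeafE (Var 1)]))
    LeafE"

abbreviation "shift_body \<equiv>
  Cond (Var 0) (Call 14 [Right (Var 0), NodeE LeafE (Var 1)]) (Var 1)"

abbreviation "labels_of_body \<equiv>
  Cond (Var 1)
    (Cond (Call 2 [Var 0, Left (Var 1)])
      (Call 13 [Left (Var 0), Var 2])
      (Call 15 [Var 0, Right (Var 1), Call 14 [Left (Left (Var 1)), Var 2]]))
    LeafE"

text \<open>\<open>NodeE TrueE LeafE\<close> is the number 1, the first label.\<close>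

abbreviation "labeling_body \<equiv>
  Cond (Var 0)
    (NodeE (Call 15 [Var 0, Var 1, NodeE TrueE LeafE]) (Call 16 [Right (Var 0), Var 1]))
    LeafE"

text \<open>Here \<open>TrueE\<close> stands for the list \<open>[False]\<close>; each element of
  the argument doubles its length.\<close>

abbreviation "exp_body \<equiv> Cond (Var 0) (Call 1 [Call 17 [Right (Var 0)], Call 17 [Right (Var 0)]]) TrueE"

text \<open>Entry 0 is left open because two programs share the subroutines: the solver, with
  \<open>main_body\<close>, and the program that computes \<open>tower\<close>.\<close>

definition prog :: "expr \<Rightarrow> program" where
  "prog m = [m, append_body, eq_body, member_body, map_cons_body, insert_all_body,
    concat_insert_all_body, schedules_body, ride_body, rides_body, filter_body, longer_body,
    best_body, block_body, shift_body, labels_of_body, labeling_body, exp_body]"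

lemma length_prog [simp]: "length (prog m) = 18"
  by (simp add: prog_def)

lemma prog_nth:
  "prog m ! 0 = m" "prog m ! 1 = append_body" "prog m ! 2 = eq_body" "prog m ! 3 = member_body"
  "prog m ! 4 = map_cons_body" "prog m ! 5 = insert_all_body" "prog m ! 6 = concat_insert_all_body"
  "prog m ! 7 = schedules_body" "prog m ! 8 = ride_body" "prog m ! 9 = rides_body"
  "prog m ! 10 = filter_body" "prog m ! 11 = longer_body" "prog m ! 12 = best_body"
  "prog m ! 13 = block_body" "prog m ! 14 = shift_body" "prog m ! 15 = labels_of_body"
  "prog m ! 16 = labeling_body" "prog m ! 17 = exp_body"
  by (simp_all add: prog_def)

section \<open>Correctness and cost of the subroutines\<close>

lemma enc_list_Leaf [simp]: "enc_list e xs = Leaf \<longleftrightarrow> xs = []" "Leaf = enc_list e xs \<longleftrightarrow> xs = []"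
  by (cases xs; simp)+

lemma nodes_enc_list_append:
  "nodes (enc_list e (xs @ ys)) + 1 = nodes (enc_list e xs) + nodes (enc_list e ys)"
  by (induction xs) auto

lemma length_less_nodes: "length xs < nodes (enc_list e xs)"
  by (induction xs) auto

lemma enc_bool_Leaf [simp]: "enc_bool b = Leaf \<longleftrightarrow> \<not> b"
  by (cases b) auto

lemma nodes_le_append:
  "nodes (enc_list e xs) \<le> nodes (enc_list e (xs @ ys))"
  "nodes (enc_list e ys) \<le> nodes (enc_list e (xs @ ys))"
  using nodes_enc_list_append[of e xs ys] nodes_pos(2)[of "enc_list e xs"]
    nodes_pos(2)[of "enc_list e ys"] by linarith+

text \<open>The index is written \<open>Suc 0\<close>, the form into which \<open>simp\<close>
  brings \<open>1\<close> while a body is executed.\<close>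

lemma calls_append:
  "nodes (enc_list e (xs @ ys)) \<le> N \<Longrightarrow>
   calls (prog m) N (Suc 0) [enc_list e xs, enc_list e ys] (enc_list e (xs @ ys)) (10 * length xs + 10)"
proof (induction xs)
  case Nil
  have "0 < N" using Nil nodes_pos(2)[of "enc_list e ys"] by (simp del: nodes_pos)
  with Nil show ?case
    apply (intro callsI[OF prog_nth(2)[simplified]])
    \<comment> \<open>Symbolic execution, as in all later cost lemmas: \<open>wp_intros\<close> runs
      through the body, \<open>calls_wpc\<close> is added where functions are called, and
      \<open>simp\<close> settles the conditions on sizes and steps.\<close>
    apply (rule wp_intros | simp)+
    done
next
  case (Cons x xs)
  from Cons.prems nodes_le_append(1)[of e xs ys] nodes_le_append(2)[of e ys xs] show ?case
    apply (intro callsI[OF prog_nth(2)[simplified]])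
    apply (rule wp_intros calls_wpc[OF Cons.IH] | simp)+
    done
qed

text \<open>The assumption \<open>2 < N\<close>, here and below, makes room for
  \<open>TrueE\<close>, a tree with three nodes.\<close>

lemma calls_eq:
  assumes "2 < N"
  shows "nodes a \<le> N \<Longrightarrow> nodes b \<le> N \<Longrightarrow>
   calls (prog m) N 2 [a, b] (enc_bool (a = b)) (20 * nodes a)"
proof (induction a arbitrary: b)
  case Leaf
  with assms show ?case
    apply (intro callsI[OF prog_nth(3)])
    apply (cases b)
    apply (rule wp_intros | simp)+
    done
next
  case (Node a1 a2)
  show ?case
  proof (cases b)
    case Leaf
    then show ?thesis using Node.prems assms
    apply (intro callsI[OF prog_nth(3)])
    apply (rule wp_intros | simp)+
    done
  next
    case (Node b1 b2)
    then show ?thesis using Node.prems assms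
    apply (intro callsI[OF prog_nth(3)])
    apply (rule wp_intros conjI impI calls_wpc[OF Node.IH(1)] calls_wpc[OF Node.IH(2)]| simp)+
    done
  qed
qed

lemma calls_eq_enc:
  assumes "2 < N" "inj e" "nodes (e x) \<le> N" "nodes (e y) \<le> N"
  shows "calls (prog m) N 2 [e x, e y] (enc_bool (x = y)) (20 * N)"
  using calls_mono[OF calls_eq[OF assms(1,3,4)], of "20 * N" m] assms(2,3) by (simp add: inj_eq)

text \<open>Pattern of most subroutines: a bound that mentions the list length survives the
  induction; afterwards \<open>length_less_nodes\<close> turns the length into one more factor
  \<open>N\<close>, so callers handle powers of \<open>N\<close> only.\<close>

lemma calls_member_length:
  assumes "2 < N" "inj e" "nodes (e x) \<le> N"
  shows "nodes (enc_list e ys) \<le> N \<Longrightarrow>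
    calls (prog m) N 3 [e x, enc_list e ys] (enc_bool (x \<in> set ys)) ((length ys + 1) * (40 * N))"
proof (induction ys)
  case Nil
  with assms show ?case
    apply (intro callsI[OF prog_nth(4)])
    apply (rule wp_intros | simp)+
    done
next
  case (Cons y ys)
  from Cons.prems assms show ?case
    apply (intro callsI[OF prog_nth(4)])
    apply (rule wp_intros conjI impI calls_wpc[OF calls_eq_enc[where e = e]] calls_wpc[OF Cons.IH] | simp)+
    done
qed

lemma calls_member:
  assumes "2 < N" "inj e" "nodes (e x) \<le> N" "nodes (enc_list e ys) \<le> N"
  shows "calls (prog m) N 3 [e x, enc_list e ys] (enc_bool (x \<in> set ys)) (40 * N^2)"
proof (rule calls_mono[OF calls_member_length[OF assms]])
  have "length ys + 1 \<le> N" using length_less_nodes[of ys e] assms(4) by linarith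
  then show "(length ys + 1) * (40 * N) \<le> 40 * N^2"
    using mult_le_mono1[of "length ys + 1" N "40 * N"] by (simp add: power2_eq_square)
qed

section \<open>Generating all schedules\<close>

lemma nodes_enc_map_Cons:
  "nodes (enc_list (enc_list e) (map ((#) y) xss)) =
    nodes (enc_list (enc_list e) xss) + length xss * (1 + nodes (e y))"
  by (induction xss) auto

lemma calls_map_Cons:
  assumes "0 < N" "nodes (e y) \<le> N"
  shows "nodes (enc_list (enc_list e) (map ((#) y) xss)) \<le> N \<Longrightarrow>
    calls (prog m) N 4 [e y, enc_list (enc_list e) xss] (enc_list (enc_list e) (map ((#) y) xss))
      (20 * length xss + 10)"
proof (induction xss)
  case Nil
  with assms show ?case
    apply (intro callsI[OF prog_nth(5)])
    apply (rule wp_intros | simp)+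
    done
next
  case (Cons xs xss)
  from Cons.prems assms nodes_enc_map_Cons[of e y xss] show ?case
    apply (intro callsI[OF prog_nth(5)])
    apply (rule wp_intros calls_wpc[OF Cons.IH] | simp)+
    done
qed

fun insert_all :: "'a \<Rightarrow> 'a list \<Rightarrow> 'a list list" where
  "insert_all x [] = [[x]]"
| "insert_all x (y # ys) = (x # y # ys) # map ((#) y) (insert_all x ys)"

lemma length_insert_all [simp]: "length (insert_all x ys) = length ys + 1"
  by (induction ys) auto

lemma nodes_insert_all:
  "nodes (e x) + nodes (enc_list e ys) + 2 < nodes (enc_list (enc_list e) (insert_all x ys))"
  by (cases ys) auto

lemma calls_insert_all_length:
  assumes "2 < N"
  shows "nodes (enc_list (enc_list e) (insert_all x ys)) \<le> N \<Longrightarrow>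
    calls (prog m) N 5 [e x, enc_list e ys] (enc_list (enc_list e) (insert_all x ys))
      ((length ys + 1) * (20 * N + 50))"
proof (induction ys)
  case Nil
  with assms show ?case
    apply (intro callsI[OF prog_nth(6)])
    apply (rule wp_intros | simp)+
    done
next
  case (Cons y ys)
  \<comment> \<open>Prepending \<open>y\<close> to all \<open>length ys + 1\<close> results of the
    recursive call has to fit into the share \<open>20 * N + 50\<close> of one round.\<close>
  have "length ys \<le> N" using Cons.prems length_less_nodes[of "insert_all x (y # ys)" "enc_list e"]
    by (simp del: insert_all.simps)
  with Cons.prems assms nodes_enc_map_Cons[of e y "insert_all x ys"] nodes_insert_all[of e x ys]
  show ?case
    apply (intro callsI[OF prog_nth(6)])
    apply (rule wp_intros calls_wpc[OF Cons.IH] calls_wpc[OF calls_map_Cons] | simp)+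
    done
qed

lemma calls_insert_all:
  assumes "2 < N" "nodes (enc_list (enc_list e) (insert_all x ys)) \<le> N"
  shows "calls (prog m) N 5 [e x, enc_list e ys] (enc_list (enc_list e) (insert_all x ys))
      (70 * N^2)"
proof (rule calls_mono[OF calls_insert_all_length[OF assms]])
  have "length ys + 1 \<le> N"
    using length_less_nodes[of "insert_all x ys" "enc_list e"] assms(2) by simp
  then have "(length ys + 1) * (20 * N + 50) \<le> N * (20 * N + 50 * N)"
    using assms(1) by (intro mult_le_mono) auto
  then show "(length ys + 1) * (20 * N + 50) \<le> 70 * N^2"
    by (simp add: power2_eq_square)
qed

lemma calls_concat_insert_all_length:
  assumes "2 < N" "nodes (e x) \<le> N"
  shows "nodes (enc_list (enc_list e) yss) \<le> N \<Longrightarrow>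
    nodes (enc_list (enc_list e) (concat (map (insert_all x) yss))) \<le> N \<Longrightarrow>
    calls (prog m) N 6 [e x, enc_list (enc_list e) yss]
      (enc_list (enc_list e) (concat (map (insert_all x) yss)))
      ((length yss + 1) * (70 * N^2 + 10 * N + 30))"
proof (induction yss)
  case Nil
  with assms show ?case
    apply (intro callsI[OF prog_nth(7)])
    apply (rule wp_intros | simp)+
    done
next
  case (Cons ys yss)
  let ?r = "concat (map (insert_all x) yss)"
  have n: "nodes (enc_list (enc_list e) (insert_all x ys @ ?r)) \<le> N" using Cons.prems by simp
  have n1: "nodes (enc_list (enc_list e) (insert_all x ys)) \<le> N"
    and n2: "nodes (enc_list (enc_list e) ?r) \<le> N"
    using n nodes_le_append[where e = "enc_list e"] le_trans by blast+
  have "length (insert_all x ys) < N"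
    using length_less_nodes[of "insert_all x ys" "enc_list e"] n1 by linarith
  with Cons.prems(1) assms n n1 n2 show ?case
    apply (intro callsI[OF prog_nth(7)])
    apply (rule wp_intros calls_wpc[OF Cons.IH] calls_wpc[OF calls_insert_all]
         calls_wpc[OF calls_append] | simp)+
    done
qed

lemma calls_concat_insert_all:
  assumes "2 < N" "nodes (e x) \<le> N" "nodes (enc_list (enc_list e) yss) \<le> N"
    "nodes (enc_list (enc_list e) (concat (map (insert_all x) yss))) \<le> N"
  shows "calls (prog m) N 6 [e x, enc_list (enc_list e) yss]
      (enc_list (enc_list e) (concat (map (insert_all x) yss))) (110 * N^3)"
proof (rule calls_mono[OF calls_concat_insert_all_length[OF assms]])
  have "length yss + 1 \<le> N"
    using length_less_nodes[of yss "enc_list e"] assms(3) by simp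
  moreover have "N \<le> N^2" "1 \<le> N^2" using assms(1) by (simp_all add: power2_eq_square)
  ultimately have "(length yss + 1) * (70 * N^2 + 10 * N + 30) \<le> N * (110 * N^2)"
    by (intro mult_le_mono) linarith+
  then show "(length yss + 1) * (70 * N^2 + 10 * N + 30) \<le> 110 * N^3"
    by (simp add: power2_eq_square power3_eq_cube)
qed

text \<open>
  A schedule is a permutation of the nonempty suffixes of the list of paths. The suffix starting at
  index \<open>i\<close> stands for the path at its head; this keeps equal paths at different indices apart.
\<close>

fun schedules :: "'a list \<Rightarrow> 'a list list list" where
  "schedules [] = [[]]"
| "schedules (p # ps) = concat (map (insert_all (p # ps)) (schedules ps))"

lemma insert_all_nonempty [simp]: "insert_all x ys \<noteq> []"
  by (cases ys) auto

lemma schedules_nonempty [simp]: "schedules ps \<noteq> []"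
  by (induction ps) auto

text \<open>Insertion only enlarges the list, so the size bound assumed for the final list of
  schedules also covers the lists of the recursive calls.\<close>

lemma nodes_concat_insert_all:
  "nodes (enc_list (enc_list e) yss) \<le>
    nodes (enc_list (enc_list e) (concat (map (insert_all x) yss)))"
proof (induction yss)
  case (Cons ys yss)
  then show ?case
    using nodes_enc_list_append[of "enc_list e" "insert_all x ys" "concat (map (insert_all x) yss)"]
      nodes_insert_all[of e x ys] by simp
qed simp

lemma calls_schedules_length:
  assumes "2 < N"
  shows "nodes (enc_list e ps) \<le> N \<Longrightarrow>
    nodes (enc_list (enc_list (enc_list e)) (schedules ps)) \<le> N \<Longrightarrow>
    calls (prog m) N 7 [enc_list e ps] (enc_list (enc_list (enc_list e)) (schedules ps))
      ((length ps + 1) * (110 * N^3 + 20))"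
proof (induction ps)
  case Nil
  with assms show ?case
    apply (intro callsI[OF prog_nth(8)])
    apply (rule wp_intros | simp)+
    done
next
  case (Cons p ps)
  have n: "nodes (enc_list (enc_list (enc_list e)) (schedules ps)) \<le> N"
    using nodes_concat_insert_all[of "enc_list e" "schedules ps" "p # ps"] Cons.prems by simp
  have c: "calls (prog m) N 6 [Node (e p) (enc_list e ps), enc_list (enc_list (enc_list e)) (schedules ps)]
    (enc_list (enc_list (enc_list e)) (schedules (p # ps))) (110 * N^3)"
    using calls_concat_insert_all[of N "enc_list e" "p # ps" "schedules ps" m] assms Cons.prems n
    by simp
  from Cons.prems assms n show ?case
    apply (intro callsI[OF prog_nth(8)])
    apply (rule wp_intros calls_wpc[OF Cons.IH] calls_wpc[OF c] | simp)+
    done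
qed

lemma calls_schedules:
  assumes "2 < N" "nodes (enc_list e ps) \<le> N"
    "nodes (enc_list (enc_list (enc_list e)) (schedules ps)) \<le> N"
  shows "calls (prog m) N 7 [enc_list e ps] (enc_list (enc_list (enc_list e)) (schedules ps))
      (130 * N^4)"
proof (rule calls_mono[OF calls_schedules_length[OF assms]])
  have "length ps + 1 \<le> N"
    using length_less_nodes[of ps e] assms(2) by simp
  moreover have "1 \<le> N^3" using assms(1) by simp
  ultimately have "(length ps + 1) * (110 * N^3 + 20) \<le> N * (130 * N^3)"
    by (intro mult_le_mono) linarith+
  then show "(length ps + 1) * (110 * N^3 + 20) \<le> 130 * N^4"
    by (simp add: power4_eq_xxxx power3_eq_cube)
qed

section \<open>Evaluating one schedule\<close>

definition ride :: "'a list \<Rightarrow> 'a list \<Rightarrow> 'a list" where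
  "ride R p = dropWhile (\<lambda>v. v \<notin> set R) p"

lemma ride_simps [simp]:
  "ride R [] = []" "ride R (v # p) = (if v \<in> set R then v # p else ride R p)"
  by (simp_all add: ride_def)

lemma nodes_ride_le: "nodes (enc_list e (ride R p)) \<le> nodes (enc_list e p)"
  by (induction p) auto

lemma calls_ride_length:
  assumes "2 < N" "inj e" "nodes (enc_list e R) \<le> N"
  shows "nodes (enc_list e p) \<le> N \<Longrightarrow>
    calls (prog m) N 8 [enc_list e R, enc_list e p] (enc_list e (ride R p))
      ((length p + 1) * (40 * N^2 + 20))"
proof (induction p)
  case Nil
  with assms show ?case
    apply (intro callsI[OF prog_nth(9)])
    apply (rule wp_intros | simp)+
    done
next
  case (Cons v p)
  from Cons.prems assms show ?case
    apply (intro callsI[OF prog_nth(9)])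
    apply (rule wp_intros conjI impI calls_wpc[OF Cons.IH] calls_wpc[OF calls_member[where e = e]] | simp)+
    done
qed

lemma calls_ride:
  assumes "2 < N" "inj e" "nodes (enc_list e R) \<le> N" "nodes (enc_list e p) \<le> N"
  shows "calls (prog m) N 8 [enc_list e R, enc_list e p] (enc_list e (ride R p)) (60 * N^3)"
proof (rule calls_mono[OF calls_ride_length[OF assms]])
  have "length p + 1 \<le> N" using length_less_nodes[of p e] assms(4) by simp
  moreover have "1 \<le> N^2" using assms(1) by simp
  ultimately have "(length p + 1) * (40 * N^2 + 20) \<le> N * (60 * N^2)"
    by (intro mult_le_mono) linarith+
  then show "(length p + 1) * (40 * N^2 + 20) \<le> 60 * N^3"
    by (simp add: power2_eq_square power3_eq_cube)
qed

text \<open>The vertices reached from \<open>R\<close> by serving the paths of a schedule one after another.\<close>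

fun rides :: "'a list \<Rightarrow> 'a list list list \<Rightarrow> 'a list" where
  "rides R [] = R"
| "rides R (\<tau> # \<pi>) = rides (ride R (hd \<tau>) @ R) \<pi>"

text \<open>The accumulated list never shrinks, so the size bound on the final list covers all
  intermediate ones.\<close>

lemma nodes_le_rides: "nodes (enc_list e R) \<le> nodes (enc_list e (rides R \<pi>))"
proof (induction \<pi> arbitrary: R)
  case (Cons \<tau> \<pi>)
  show ?case
    using Cons.IH[of "ride R (hd \<tau>) @ R"] nodes_le_append(2)[of e R "ride R (hd \<tau>)"] by simp
qed simp

lemma lft_enc_list [simp]: "\<tau> \<noteq> [] \<Longrightarrow> lft (enc_list e \<tau>) = e (hd \<tau>)"
  by (cases \<tau>) auto

lemma nodes_hd_less: "\<tau> \<noteq> [] \<Longrightarrow> nodes (e (hd \<tau>)) < nodes (enc_list e \<tau>)"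
  by (cases \<tau>) auto

text \<open>\<open>[] \<notin> set \<pi>\<close> guarantees that \<open>hd\<close> agrees with what
  the machine reads by \<open>Left\<close>.\<close>

lemma calls_rides_length:
  assumes "2 < N" "inj e"
  shows "nodes (enc_list (enc_list (enc_list e)) \<pi>) \<le> N \<Longrightarrow> [] \<notin> set \<pi> \<Longrightarrow>
    nodes (enc_list e (rides R \<pi>)) \<le> N \<Longrightarrow>
    calls (prog m) N 9 [enc_list e R, enc_list (enc_list (enc_list e)) \<pi>] (enc_list e (rides R \<pi>))
      ((length \<pi> + 1) * (60 * N^3 + 10 * N + 40))"
proof (induction \<pi> arbitrary: R)
  case Nil
  with assms show ?case
    apply (intro callsI[OF prog_nth(10)])
    apply (rule wp_intros | simp)+
    done
next
  case (Cons \<tau> \<pi>)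
  let ?r = "ride R (hd \<tau>)"
  have \<tau>: "\<tau> \<noteq> []" using Cons.prems(2) by auto
  have h: "nodes (enc_list e (hd \<tau>)) \<le> N"
    using nodes_hd_less[OF \<tau>, of "enc_list e"] Cons.prems(1) by simp
  have "nodes (enc_list e (?r @ R)) \<le> N"
    using nodes_le_rides[of e "?r @ R" \<pi>] Cons.prems(3) by simp
  moreover have "length ?r \<le> N"
    using length_less_nodes[of ?r e] nodes_ride_le[of e R "hd \<tau>"] h by linarith
  moreover have "nodes (enc_list e R) \<le> nodes (enc_list e (?r @ R))"
    by (rule nodes_le_append(2))
  moreover have "nodes (enc_list e ?r) \<le> nodes (enc_list e (?r @ R))"
    by (rule nodes_le_append(1))
  ultimately show ?case using Cons.prems assms h \<tau>
    apply (intro callsI[OF prog_nth(10)])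
    apply (rule wp_intros calls_wpc[OF Cons.IH] calls_wpc[OF calls_ride]
         calls_wpc[OF calls_append] | simp)+
    done
qed

lemma calls_rides:
  assumes "2 < N" "inj e" "nodes (enc_list (enc_list (enc_list e)) \<pi>) \<le> N" "[] \<notin> set \<pi>"
    "nodes (enc_list e (rides R \<pi>)) \<le> N"
  shows "calls (prog m) N 9 [enc_list e R, enc_list (enc_list (enc_list e)) \<pi>]
      (enc_list e (rides R \<pi>)) (110 * N^4)"
proof (rule calls_mono[OF calls_rides_length[OF assms]])
  have "length \<pi> + 1 \<le> N" using length_less_nodes[of \<pi> "enc_list (enc_list e)"] assms(3) by simp
  moreover have "1 \<le> N^3" "N \<le> N^3" using assms(1) by (simp_all add: power3_eq_cube)
  ultimately have "(length \<pi> + 1) * (60 * N^3 + 10 * N + 40) \<le> N * (110 * N^3)"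
    by (intro mult_le_mono) linarith+
  then show "(length \<pi> + 1) * (60 * N^3 + 10 * N + 40) \<le> 110 * N^4"
    by (simp add: power4_eq_xxxx power3_eq_cube)
qed

lemma nodes_filter_le: "nodes (enc_list e (filter Q xs)) \<le> nodes (enc_list e xs)"
  by (induction xs) auto

lemma calls_filter_length:
  assumes "2 < N" "inj e" "nodes (enc_list e R) \<le> N"
  shows "nodes (enc_list e vs) \<le> N \<Longrightarrow>
    calls (prog m) N 10 [enc_list e R, enc_list e vs] (enc_list e (filter (\<lambda>v. v \<in> set R) vs))
      ((length vs + 1) * (40 * N^2 + 30))"
proof (induction vs)
  case Nil
  with assms show ?case
    apply (intro callsI[OF prog_nth(11)])
    apply (rule wp_intros | simp)+
    done
next
  case (Cons v vs)
  from Cons.prems assms nodes_filter_le[of e "\<lambda>v. v \<in> set R" vs] show ?case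
    apply (intro callsI[OF prog_nth(11)])
    apply (rule wp_intros conjI impI calls_wpc[OF Cons.IH] calls_wpc[OF calls_member[where e = e]] | simp)+
    done
qed

lemma calls_filter:
  assumes "2 < N" "inj e" "nodes (enc_list e R) \<le> N" "nodes (enc_list e vs) \<le> N"
  shows "calls (prog m) N 10 [enc_list e R, enc_list e vs]
    (enc_list e (filter (\<lambda>v. v \<in> set R) vs)) (70 * N^3)"
proof (rule calls_mono[OF calls_filter_length[OF assms]])
  have "length vs + 1 \<le> N" using length_less_nodes[of vs e] assms(4) by simp
  moreover have "1 \<le> N^2" using assms(1) by simp
  ultimately have "(length vs + 1) * (40 * N^2 + 30) \<le> N * (70 * N^2)"
    by (intro mult_le_mono) linarith+
  then show "(length vs + 1) * (40 * N^2 + 30) \<le> 70 * N^3"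
    by (simp add: power2_eq_square power3_eq_cube)
qed

section \<open>Selecting the best schedule\<close>

lemma calls_longer:
  assumes "2 < N"
  shows "nodes (enc_list e xs) \<le> N \<Longrightarrow> nodes (enc_list e ys) \<le> N \<Longrightarrow>
    calls (prog m) N 11 [enc_list e xs, enc_list e ys] (enc_bool (length ys \<le> length xs))
      (20 * length xs + 20)"
proof (induction xs arbitrary: ys)
  case Nil
  with assms show ?case
    apply (intro callsI[OF prog_nth(12)])
    apply (cases ys)
    apply (rule wp_intros | simp)+
    done
next
  case (Cons x xs)
  show ?case
  proof (cases ys)
    case Nil
    with Cons.prems assms show ?thesis
      apply (intro callsI[OF prog_nth(12)])
      apply (rule wp_intros | simp)+
      done
  next
    case (Cons y ys')
    with Cons.prems assms show ?thesis
      apply (intro callsI[OF prog_nth(12)])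
      apply (rule wp_intros calls_wpc[OF Cons.IH] | simp)+
      done
  qed
qed

text \<open>\<open>rides\<close> accumulates repetitions; filtering a duplicate-free vertex list
  instead counts every reached vertex once.\<close>

definition score :: "'a list \<Rightarrow> 'a list \<Rightarrow> 'a list list list \<Rightarrow> nat" where
  "score R vs \<pi> = length (filter (\<lambda>v. v \<in> set (rides R \<pi>)) vs)"

fun best :: "'a list \<Rightarrow> 'a list \<Rightarrow> 'a list list list \<Rightarrow> 'a list list list list \<Rightarrow> 'a list list list" where
  "best R vs \<sigma> [] = \<sigma>"
| "best R vs \<sigma> (\<pi> # \<pi>s) =
    (if score R vs \<pi> \<le> score R vs \<sigma> then best R vs \<sigma> \<pi>s else best R vs \<pi> \<pi>s)"

definition small_schedule :: "nat \<Rightarrow> ('a \<Rightarrow> data) \<Rightarrow> 'a list \<Rightarrow> 'a list list list \<Rightarrow> bool" where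
  "small_schedule N e R \<pi> \<longleftrightarrow> nodes (enc_list (enc_list (enc_list e)) \<pi>) \<le> N \<and> [] \<notin> set \<pi> \<and>
    nodes (enc_list e (rides R \<pi>)) \<le> N"

lemma calls_best_length:
  assumes "2 < N" "inj e" "nodes (enc_list e R) \<le> N" "nodes (enc_list e vs) \<le> N"
  shows "small_schedule N e R \<sigma> \<Longrightarrow> \<forall>\<pi>\<in>set \<pi>s. small_schedule N e R \<pi> \<Longrightarrow>
    nodes (enc_list (enc_list (enc_list (enc_list e))) \<pi>s) \<le> N \<Longrightarrow>
    calls (prog m) N 12 [enc_list e R, enc_list e vs, enc_list (enc_list (enc_list e)) \<sigma>,
        enc_list (enc_list (enc_list (enc_list e))) \<pi>s]
      (enc_list (enc_list (enc_list e)) (best R vs \<sigma> \<pi>s))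
      ((length \<pi>s + 1) * (220 * N^4 + 140 * N^3 + 20 * N + 100))"
proof (induction \<pi>s arbitrary: \<sigma>)
  case Nil
  with assms show ?case
    apply (intro callsI[OF prog_nth(13)])
    apply (unfold small_schedule_def)
    apply (rule wp_intros | simp)+
    done
next
  case (Cons \<pi> \<pi>s)
  let ?f = "\<lambda>\<pi>. filter (\<lambda>v. v \<in> set (rides R \<pi>)) vs"
  have f: "nodes (enc_list e (?f \<pi>)) \<le> N" for \<pi>
    using nodes_filter_le[of e "\<lambda>v. v \<in> set (rides R \<pi>)" vs] assms(4) by simp
  have l: "length (?f \<sigma>) \<le> N" using f[of \<sigma>] length_less_nodes[of "?f \<sigma>" e] by linarith
  have \<sigma>: "nodes (enc_list (enc_list (enc_list e)) \<sigma>) \<le> N" "[] \<notin> set \<sigma>"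
    "nodes (enc_list e (rides R \<sigma>)) \<le> N"
    using Cons.prems(1) by (auto simp: small_schedule_def)
  have \<pi>: "nodes (enc_list (enc_list (enc_list e)) \<pi>) \<le> N" "[] \<notin> set \<pi>"
    "nodes (enc_list e (rides R \<pi>)) \<le> N"
    using Cons.prems(2) by (auto simp: small_schedule_def)
  \<comment> \<open>The induction hypothesis for both possible incumbents, since the comparison may
    go either way.\<close>
  have c: "calls (prog m) N 12 [enc_list e R, enc_list e vs, enc_list (enc_list (enc_list e)) \<rho>,
        enc_list (enc_list (enc_list (enc_list e))) \<pi>s]
      (enc_list (enc_list (enc_list e)) (best R vs \<rho> \<pi>s))
      ((length \<pi>s + 1) * (220 * N^4 + 140 * N^3 + 20 * N + 100))" if "\<rho> \<in> {\<sigma>, \<pi>}" for \<rho>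
    using that Cons.prems by (intro Cons.IH) auto
  note c\<sigma> = c[of \<sigma>, simplified] note c\<pi> = c[of \<pi>, simplified]
  from Cons.prems(3) assms \<sigma> \<pi> f[of \<sigma>] f[of \<pi>] l show ?case
    apply (intro callsI[OF prog_nth(13)])
    apply (rule wp_intros conjI impI calls_wpc[OF c\<sigma>] calls_wpc[OF c\<pi>] calls_wpc[OF calls_rides[where e = e]]
      calls_wpc[OF calls_filter[where e = e]] calls_wpc[OF calls_longer[where e = e]]
      | simp add: score_def)+
    done
qed

lemma calls_best:
  assumes "2 < N" "inj e" "nodes (enc_list e R) \<le> N" "nodes (enc_list e vs) \<le> N"
    "small_schedule N e R \<sigma>" "\<forall>\<pi>\<in>set \<pi>s. small_schedule N e R \<pi>"
    "nodes (enc_list (enc_list (enc_list (enc_list e))) \<pi>s) \<le> N"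
  shows "calls (prog m) N 12 [enc_list e R, enc_list e vs, enc_list (enc_list (enc_list e)) \<sigma>,
        enc_list (enc_list (enc_list (enc_list e))) \<pi>s]
      (enc_list (enc_list (enc_list e)) (best R vs \<sigma> \<pi>s)) (480 * N^5)"
proof (rule calls_mono[OF calls_best_length[OF assms]])
  have "length \<pi>s + 1 \<le> N"
    using length_less_nodes[of \<pi>s "enc_list (enc_list (enc_list e))"] assms(7) by simp
  moreover have "1 \<le> N^4" "N \<le> N^4" "N^3 \<le> N^4"
    using assms(1) power_increasing[of 1 4 N] power_increasing[of 3 4 N] by simp_all
  ultimately have "(length \<pi>s + 1) * (220 * N^4 + 140 * N^3 + 20 * N + 100) \<le> N * (480 * N^4)"
    by (intro mult_le_mono) auto
  then show "(length \<pi>s + 1) * (220 * N^4 + 140 * N^3 + 20 * N + 100) \<le> 480 * N^5"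
    by (simp add: power_numeral_reduce)
qed

section \<open>Writing down the labels\<close>

text \<open>
  The labels are powers of two, because doubling a number prepends a single bit to its encoding.
\<close>

fun block :: "'a list \<Rightarrow> nat \<Rightarrow> int list" where
  "block [] t = []"
| "block [v] t = []"
| "block (v # w # p) t = int t # block (w # p) (2 * t)"

text \<open>Fails for \<open>t = 0\<close>, which is encoded without any bit; hence the condition
  \<open>0 < t\<close> in the lemmas on labels.\<close>

lemma enc_nat_double: "0 < t \<Longrightarrow> enc_nat (2 * t) = Node Leaf (enc_nat t)"
  by (subst enc_nat.simps) simp

lemma enc_int_of_nat: "enc_int (int t) = Node Leaf (enc_nat t)"
  by (simp add: enc_int_def)

text \<open>Each doubling adds two nodes to the encoding of \<open>t\<close> while the path loses
  one vertex, so \<open>nodes (enc_nat t) + 2 * length p\<close> is invariant under the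
  recursion.\<close>

lemma calls_block:
  assumes "2 < N"
  shows "0 < t \<Longrightarrow> nodes (enc_list e p) \<le> N \<Longrightarrow> nodes (enc_nat t) + 2 * length p \<le> N \<Longrightarrow>
    nodes (enc_list enc_int (block p t)) \<le> N \<Longrightarrow>
    calls (prog m) N 13 [enc_list e p, enc_nat t] (enc_list enc_int (block p t)) (20 * length p + 20)"
proof (induction p t rule: block.induct)
  case (1 t)
  with assms show ?case
    apply (intro callsI[OF prog_nth(14)])
    apply (rule wp_intros | simp)+
    done
next
  case (2 v t)
  with assms show ?case
    apply (intro callsI[OF prog_nth(14)])
    apply (rule wp_intros | simp)+
    done
next
  case (3 v w p t)
  then have IH: "calls (prog m) N 13 [Node (e w) (enc_list e p), Node Leaf (enc_nat t)]
    (enc_list enc_int (block (w # p) (2 * t))) (40 + 20 * length p)"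
    by (simp add: enc_nat_double)
  from 3(2-) assms show ?case
    apply (intro callsI[OF prog_nth(14)])
    apply (rule wp_intros calls_wpc[OF IH] | simp add: enc_int_of_nat)+
    done
qed

lemma calls_shift:
  assumes "2 < N"
  shows "0 < t \<Longrightarrow> nodes (enc_list e p) \<le> N \<Longrightarrow> nodes (enc_nat t) + 2 * length p \<le> N \<Longrightarrow>
    calls (prog m) N 14 [enc_list e p, enc_nat t] (enc_nat (t * 2 ^ length p)) (20 * length p + 20)"
proof (induction p arbitrary: t)
  case Nil
  with assms show ?case
    apply (intro callsI[OF prog_nth(15)])
    apply (rule wp_intros | simp)+
    done
next
  case (Cons v p)
  have IH: "calls (prog m) N 14 [enc_list e p, Node Leaf (enc_nat t)]
    (enc_nat (t * 2 ^ length (v # p))) (20 * length p + 20)"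
  proof -
    have "t * 2 ^ length (v # p) = 2 * t * 2 ^ length p" by simp
    then show ?thesis using Cons.IH[of "2 * t"] Cons.prems by (simp only: enc_nat_double) simp
  qed
  from Cons.prems assms show ?case
    apply (intro callsI[OF prog_nth(15)])
    apply (rule wp_intros calls_wpc[OF IH] | simp)+
    done
qed

lemma nodes_enc_nat_shift: "0 < t \<Longrightarrow> nodes (enc_nat (t * 2 ^ l)) = nodes (enc_nat t) + 2 * l"
proof (induction l arbitrary: t)
  case (Suc l)
  have "t * 2 ^ Suc l = 2 * t * 2 ^ l" by simp
  then show ?case using Suc.IH[of "2 * t"] Suc.prems by (simp only: enc_nat_double) simp
qed simp

text \<open>Every path passed over shifts the start by \<open>length (hd \<sigma>)\<close>
  exponents, one more than it has edges. The machine can thus shift by recursion on the vertex list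
  itself, and all labels of that path stay below the next start.\<close>

fun labels_of :: "'a list list \<Rightarrow> 'a list list list \<Rightarrow> nat \<Rightarrow> int list" where
  "labels_of \<tau> [] t = []"
| "labels_of \<tau> (\<sigma> # \<pi>) t =
    (if \<tau> = \<sigma> then block (hd \<tau>) t else labels_of \<tau> \<pi> (t * 2 ^ length (hd \<sigma>)))"

lemma calls_labels_of_length:
  assumes "2 < N" "inj e" "\<tau> \<noteq> []" "nodes (enc_list (enc_list e) \<tau>) \<le> N"
  shows "0 < t \<Longrightarrow> nodes (enc_list (enc_list (enc_list e)) \<pi>) \<le> N \<Longrightarrow> [] \<notin> set \<pi> \<Longrightarrow>
    nodes (enc_nat t) + 2 * (\<Sum>\<sigma>\<leftarrow>\<pi>. length (hd \<sigma>)) \<le> N \<Longrightarrow>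
    nodes (enc_list enc_int (labels_of \<tau> \<pi> t)) \<le> N \<Longrightarrow>
    calls (prog m) N 15 [enc_list (enc_list e) \<tau>, enc_list (enc_list (enc_list e)) \<pi>, enc_nat t]
      (enc_list enc_int (labels_of \<tau> \<pi> t)) ((length \<pi> + 1) * (40 * N + 100))"
proof (induction \<pi> arbitrary: t)
  case Nil
  with assms show ?case
    apply (intro callsI[OF prog_nth(16)])
    apply (rule wp_intros | simp)+
    done
next
  case (Cons \<sigma> \<pi>)
  have \<sigma>: "\<sigma> \<noteq> []" using Cons.prems by auto
  have i: "inj (enc_list (enc_list e))" by (intro inj_enc_list assms)
  have h\<tau>: "nodes (enc_list e (hd \<tau>)) \<le> N" and h\<sigma>: "nodes (enc_list e (hd \<sigma>)) \<le> N"
    using nodes_hd_less[OF assms(3), of "enc_list e"] nodes_hd_less[OF \<sigma>, of "enc_list e"]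
      assms(4) Cons.prems(2) by auto
  have l: "length (hd \<tau>) \<le> N" "length (hd \<sigma>) \<le> N"
    using length_less_nodes[of "hd \<tau>" e] length_less_nodes[of "hd \<sigma>" e] h\<tau> h\<sigma> by auto
  have n: "nodes (enc_list (enc_list e) \<sigma>) \<le> N" using Cons.prems(2) by simp
  have s: "nodes (enc_nat (t * 2 ^ length (hd \<sigma>))) + 2 * (\<Sum>\<sigma>\<leftarrow>\<pi>. length (hd \<sigma>)) \<le> N"
    using Cons.prems(1,4) by (simp add: nodes_enc_nat_shift)
  have nt: "nodes (enc_nat t) \<le> N" "nodes (enc_nat t) + 2 * length (hd \<sigma>) \<le> N"
    using Cons.prems(4) by auto
  from Cons.prems(1,2,3,5) assms \<sigma> h\<tau> h\<sigma> l n s nt i show ?case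
    apply (intro callsI[OF prog_nth(16)])
    apply (rule wp_intros conjI impI calls_wpc[OF calls_eq_enc[OF assms(1) i]]
      calls_wpc[OF calls_block] calls_wpc[OF calls_shift] calls_wpc[OF Cons.IH] | simp)+
    done
qed

lemma calls_labels_of:
  assumes "2 < N" "inj e" "\<tau> \<noteq> []" "nodes (enc_list (enc_list e) \<tau>) \<le> N"
    "0 < t" "nodes (enc_list (enc_list (enc_list e)) \<pi>) \<le> N" "[] \<notin> set \<pi>"
    "nodes (enc_nat t) + 2 * (\<Sum>\<sigma>\<leftarrow>\<pi>. length (hd \<sigma>)) \<le> N"
    "nodes (enc_list enc_int (labels_of \<tau> \<pi> t)) \<le> N"
  shows "calls (prog m) N 15
      [enc_list (enc_list e) \<tau>, enc_list (enc_list (enc_list e)) \<pi>, enc_nat t]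
      (enc_list enc_int (labels_of \<tau> \<pi> t)) (140 * N^2)"
proof (rule calls_mono[OF calls_labels_of_length[OF assms]])
  have "length \<pi> + 1 \<le> N" using length_less_nodes[of \<pi> "enc_list (enc_list e)"] assms(6) by simp
  then have "(length \<pi> + 1) * (40 * N + 100) \<le> N * (140 * N)"
    using assms(1) by (intro mult_le_mono) linarith+
  then show "(length \<pi> + 1) * (40 * N + 100) \<le> 140 * N^2"
    by (simp add: power2_eq_square)
qed

fun labeling :: "'a list list \<Rightarrow> 'a list list list \<Rightarrow> int list list" where
  "labeling [] \<pi> = []"
| "labeling (p # ps) \<pi> = labels_of (p # ps) \<pi> 1 # labeling ps \<pi>"

lemma enc_nat_1: "enc_nat (Suc 0) = Node (Node Leaf Leaf) Leaf"
  by (simp add: enc_nat.simps)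

text \<open>The \<open>5\<close> is the size of the encoding of 1, where the labels start; the sum
  allows two nodes for each shift along the schedule.\<close>

lemma calls_labeling_length:
  assumes "4 < N" "inj e" "nodes (enc_list (enc_list (enc_list e)) \<pi>) \<le> N" "[] \<notin> set \<pi>"
    "5 + 2 * (\<Sum>\<sigma>\<leftarrow>\<pi>. length (hd \<sigma>)) \<le> N"
  shows "nodes (enc_list (enc_list e) ps) \<le> N \<Longrightarrow>
    nodes (enc_list (enc_list enc_int) (labeling ps \<pi>)) \<le> N \<Longrightarrow>
    calls (prog m) N 16 [enc_list (enc_list e) ps, enc_list (enc_list (enc_list e)) \<pi>]
      (enc_list (enc_list enc_int) (labeling ps \<pi>)) ((length ps + 1) * (140 * N^2 + 30))"
proof (induction ps)
  case Nil
  with assms show ?case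
    apply (intro callsI[OF prog_nth(17)])
    apply (rule wp_intros | simp)+
    done
next
  case (Cons p ps)
  have c: "calls (prog m) N 15 [Node (enc_list e p) (enc_list (enc_list e) ps),
      enc_list (enc_list (enc_list e)) \<pi>, Node (Node Leaf Leaf) Leaf]
      (enc_list enc_int (labels_of (p # ps) \<pi> (Suc 0))) (140 * N^2)"
    using calls_labels_of[of N e "p # ps" "Suc 0" \<pi> m] assms Cons.prems by (simp add: enc_nat_1)
  from Cons.prems assms show ?case
    apply (intro callsI[OF prog_nth(17)])
    apply (rule wp_intros calls_wpc[OF c] calls_wpc[OF Cons.IH] | simp)+
    done
qed

lemma calls_labeling:
  assumes "4 < N" "inj e" "nodes (enc_list (enc_list (enc_list e)) \<pi>) \<le> N" "[] \<notin> set \<pi>"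
    "5 + 2 * (\<Sum>\<sigma>\<leftarrow>\<pi>. length (hd \<sigma>)) \<le> N"
    "nodes (enc_list (enc_list e) ps) \<le> N"
    "nodes (enc_list (enc_list enc_int) (labeling ps \<pi>)) \<le> N"
  shows "calls (prog m) N 16 [enc_list (enc_list e) ps, enc_list (enc_list (enc_list e)) \<pi>]
      (enc_list (enc_list enc_int) (labeling ps \<pi>)) (170 * N^3)"
proof (rule calls_mono[OF calls_labeling_length[OF assms]])
  have "length ps + 1 \<le> N" using length_less_nodes[of ps "enc_list e"] assms(6) by simp
  moreover have "1 \<le> N^2" using assms(1) by simp
  ultimately have "(length ps + 1) * (140 * N^2 + 30) \<le> N * (170 * N^2)"
    by (intro mult_le_mono) linarith+
  then show "(length ps + 1) * (140 * N^2 + 30) \<le> 170 * N^3"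
    by (simp add: power2_eq_square power3_eq_cube)
qed

lemma calls_runs:
  assumes "calls P N 0 [d] v c" "0 < length P" "nodes d \<le> N"
  shows "\<exists>t \<le> (c + 2) * N. runs P d v t"
proof -
  \<comment> \<open>The two additional steps are reading the input and the outer call.\<close>
  have "wp P N [d] (Call 0 [Var 0]) (\<lambda>v' c'. v' = v \<and> c' \<le> c + 2)"
    using assms(2,3) by (intro wp_intros calls_wpc[OF assms(1)]; simp)+
  then obtain c' t where "c' \<le> c + 2" "t \<le> c' * N" "runs P d v t"
    unfolding wp_def ev_def runs_def by blast
  moreover have "c' * N \<le> (c + 2) * N" using \<open>c' \<le> c + 2\<close> by (rule mult_le_mono1)
  ultimately show ?thesis by (meson le_trans)
qed

section \<open>The parameter bound\<close>

fun bits :: "nat \<Rightarrow> bool list" where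
  "bits n = (if n = 0 then [] else odd n # bits (n div 2))"

declare bits.simps [simp del]

text \<open>An encoded number is also an encoded list, so the list subroutines can compute with
  numbers.\<close>

lemma enc_nat_bits: "enc_nat n = enc_list enc_bool (bits n)"
proof (induction n rule: bits.induct)
  case (1 n)
  then show ?case by (simp add: enc_nat.simps[of n] bits.simps[of n])
qed

lemma less_power_length_bits: "n < 2 ^ length (bits n)"
proof (induction n rule: bits.induct)
  case (1 n)
  then show ?case by (cases "n = 0") (auto simp: bits.simps[of n])
qed

lemma enc_nat_power: "enc_nat (2 ^ n) = enc_list enc_bool (replicate n False @ [True])"
  by (induction n) (simp_all add: enc_nat_1 enc_nat_double)

lemma nodes_replicate_False: "nodes (enc_list enc_bool (replicate n False)) = 2 * n + 1"
  by (induction n) auto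

text \<open>Some step count suffices, because \<open>computable\<close> asks for termination only.
  The result has \<open>2 * 2 ^ length bs + 1\<close> nodes.\<close>

lemma calls_exp:
  assumes "2 < N"
  shows "nodes (enc_list enc_bool bs) \<le> N \<Longrightarrow> 2 * 2 ^ length bs + 1 \<le> N \<Longrightarrow>
    \<exists>c. calls (prog m) N 17 [enc_list enc_bool bs]
      (enc_list enc_bool (replicate (2 ^ length bs) False)) c"
proof (induction bs)
  case Nil
  from assms show ?case
    apply (intro exI[of _ 10] callsI[OF prog_nth(18)])
    apply (rule wp_intros | simp)+
    done
next
  case (Cons b bs)
  let ?r = "replicate (2 ^ length bs) False"
  obtain c where c: "calls (prog m) N 17 [enc_list enc_bool bs] (enc_list enc_bool ?r) c"
    using Cons by auto
  have e: "replicate (2 ^ length (b # bs)) False = ?r @ ?r"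
    by (simp add: replicate_add[symmetric] mult_2)
  have n: "nodes (enc_list enc_bool (?r @ ?r)) \<le> N"
    using Cons.prems(2) nodes_replicate_False[of "2 ^ length (b # bs)"] by (simp add: e[symmetric])
  from Cons.prems assms n show ?case
    unfolding e
    apply (intro exI[of _ "2 * c + 10 * length ?r + 30"] callsI[OF prog_nth(18)])
    apply (rule wp_intros calls_wpc[OF c] calls_wpc[OF calls_append] | simp)+
    done
qed

text \<open>Three of the exponentials are calls of \<open>exp_body\<close>, starting from the bit
  length of \<open>k\<close>; the outermost one costs a single append, since \<open>n\<close> zero
  bits followed by a one are the number \<open>2 ^ n\<close>.\<close>

definition tower :: "nat \<Rightarrow> nat" where
  "tower k = 2 ^ 2 ^ 2 ^ 2 ^ length (bits k)"

lemma computable_tower: "computable tower"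
proof -
  define m where "m = Call 1 [Call 17 [Call 17 [Call 17 [Var 0]]], NodeE TrueE LeafE]"
  have body: "prog m ! 0 = Call 1 [Call 17 [Call 17 [Call 17 [Var 0]]], NodeE TrueE LeafE]"
    by (simp only: prog_nth m_def)
  have "\<exists>t. runs (prog m) (enc_nat k) (enc_nat (tower k)) t" for k
  proof -
    let ?l = "length (bits k)" and ?r = "\<lambda>n. enc_list enc_bool (replicate n False)"
    \<comment> \<open>Room for the input, for the three lists of zeros (\<open>2 * n + 1\<close>
      nodes for \<open>n\<close> zeros) and for the final bit.\<close>
    define N where "N = nodes (enc_nat k) + 2 * 2 ^ 2 ^ 2 ^ ?l + 2 * 2 ^ 2 ^ ?l + 2 * 2 ^ ?l + 20"
    have N: "2 < N" "nodes (enc_nat k) \<le> N" "2 * 2 ^ ?l + 1 \<le> N" "2 * 2 ^ 2 ^ ?l + 1 \<le> N"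
      "2 * 2 ^ 2 ^ 2 ^ ?l + 6 \<le> N"
      unfolding N_def by linarith+
    obtain c1 where c1: "calls (prog m) N 17 [enc_nat k] (?r (2 ^ ?l)) c1"
      using calls_exp[of N "bits k"] N by (auto simp: enc_nat_bits)
    obtain c2 where c2: "calls (prog m) N 17 [?r (2 ^ ?l)] (?r (2 ^ 2 ^ ?l)) c2"
      using calls_exp[of N "replicate (2 ^ ?l) False"] N by (auto simp: nodes_replicate_False)
    obtain c3 where c3: "calls (prog m) N 17 [?r (2 ^ 2 ^ ?l)] (?r (2 ^ 2 ^ 2 ^ ?l)) c3"
      using calls_exp[of N "replicate (2 ^ 2 ^ ?l) False"] N by (auto simp: nodes_replicate_False)
    have "nodes (enc_list enc_bool (replicate (2 ^ 2 ^ 2 ^ ?l) False @ [True])) \<le> N"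
      using N(5) nodes_enc_list_append[of enc_bool "replicate (2 ^ 2 ^ 2 ^ ?l) False" "[True]"]
      by (simp add: nodes_replicate_False)
    from calls_append[OF this, of m]
    have c4: "calls (prog m) N (Suc 0) [?r (2 ^ 2 ^ 2 ^ ?l), Node (Node Leaf Leaf) Leaf]
      (enc_nat (tower k)) (10 * 2 ^ 2 ^ 2 ^ ?l + 10)"
      by (simp add: tower_def enc_nat_power)
    have "calls (prog m) N 0 [enc_nat k] (enc_nat (tower k))
      (c1 + c2 + c3 + 10 * 2 ^ 2 ^ 2 ^ ?l + 30)"
      using N
      apply (intro callsI[OF body])
      apply (rule wp_intros calls_wpc[OF c1] calls_wpc[OF c2] calls_wpc[OF c3] calls_wpc[OF c4]
         | simp)+
      done
    from calls_runs[OF this] N(2) show ?thesis by auto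
  qed
  then show ?thesis unfolding computable_def by blast
qed

text \<open>The sixth power is that of \<open>N^6\<close> in \<open>runs_main\<close>. From
  \<open>k! \<le> k^k \<le> 2^(k*k)\<close> the exponent becomes \<open>6 * (k * k)\<close>, which
  is at most \<open>2^2^(k+1)\<close>, and \<open>k + 1\<close> is at most
  \<open>2 ^ length (bits k)\<close>.\<close>

lemma fact_power_le_tower: "fact k ^ 6 \<le> tower k"
proof -
  have a: "3 * n \<le> 2 ^ 2 ^ n" for n :: nat
  proof (induction n)
    case (Suc n)
    show ?case
    proof (cases "n = 0")
      case False
      let ?x = "2 ^ 2 ^ n :: nat"
      have "3 \<le> ?x" using Suc False by linarith
      then have "?x + 3 \<le> 2 * ?x" by simp
      also have "\<dots> \<le> ?x * ?x" using \<open>3 \<le> ?x\<close> by (intro mult_le_mono) auto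
      also have "\<dots> = 2 ^ 2 ^ Suc n" by (simp add: power_add[symmetric] mult_2)
      finally show ?thesis using Suc by simp
    qed simp
  qed simp
  have "6 * (k * k) \<le> (3 * k) * (3 * k)" by simp
  also have "\<dots> \<le> 2 ^ 2 ^ k * 2 ^ 2 ^ k" by (intro mult_le_mono a)
  also have "\<dots> = 2 ^ 2 ^ Suc k" by (simp add: power_add[symmetric] mult_2)
  also have "\<dots> \<le> (2::nat) ^ 2 ^ 2 ^ length (bits k)"
    using less_power_length_bits[of k] by (intro power_increasing) auto
  finally have b: "6 * (k * k) \<le> (2::nat) ^ 2 ^ 2 ^ length (bits k)" .
  have "fact k \<le> k ^ k" using fact_le_power[of k, where 'a = nat] by simp
  also have "\<dots> \<le> (2 ^ k) ^ k" by (rule power_mono) (simp_all add: less_imp_le)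
  finally have "fact k ^ 6 \<le> (((2::nat) ^ k) ^ k) ^ 6" by (intro power_mono) auto
  also have "\<dots> = 2 ^ (6 * (k * k))" by (simp add: power_mult[symmetric] mult.commute)
  also have "\<dots> \<le> tower k" unfolding tower_def using b by (intro power_increasing) auto
  finally show ?thesis .
qed

section \<open>The running time of the main program\<close>

definition tails :: "'a list \<Rightarrow> 'a list list" where
  "tails ps = map (\<lambda>i. drop i ps) [0..<length ps]"

lemma tails_simps [simp]: "tails [] = []" "tails (p # ps) = (p # ps) # tails ps"
  by (simp_all add: tails_def upt_conv_Cons map_Suc_upt[symmetric] comp_def del: upt_Suc map_Suc_upt)

lemma mset_insert_all: "zs \<in> set (insert_all x ys) \<Longrightarrow> mset zs = add_mset x (mset ys)"
  by (induction ys arbitrary: zs) auto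

lemma insert_all_append: "as @ x # bs \<in> set (insert_all x (as @ bs))"
proof (induction as)
  case Nil
  show ?case by (cases bs) auto
qed auto

text \<open>For the converse inclusion, a permutation is split at the longest suffix
  \<open>p # ps\<close>; deleting it leaves a permutation of the remaining suffixes.\<close>

lemma set_schedules: "\<pi> \<in> set (schedules ps) \<longleftrightarrow> mset \<pi> = mset (tails ps)"
proof (induction ps arbitrary: \<pi>)
  case (Cons p ps)
  show ?case
  proof
    assume "\<pi> \<in> set (schedules (p # ps))"
    then show "mset \<pi> = mset (tails (p # ps))" using Cons by (auto dest!: mset_insert_all)
  next
    assume *: "mset \<pi> = mset (tails (p # ps))"
    then have "p # ps \<in> set \<pi>" by (metis tails_simps(2) list.set_intros(1) set_mset_mset)
    then obtain as bs where \<pi>: "\<pi> = as @ (p # ps) # bs" by (meson split_list)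
    then have "as @ bs \<in> set (schedules ps)" using Cons * by simp
    then show "\<pi> \<in> set (schedules (p # ps))" using \<pi> insert_all_append by force
  qed
qed auto

lemma length_tails [simp]: "length (tails ps) = length ps"
  by (simp add: tails_def)

lemma length_schedule: "\<pi> \<in> set (schedules ps) \<Longrightarrow> length \<pi> = length ps"
  using mset_eq_length[of \<pi> "tails ps"] by (simp add: set_schedules)

lemma length_schedules: "length (schedules ps) = fact (length ps)"
proof (induction ps)
  case (Cons p ps)
  have "length (schedules (p # ps)) = (\<Sum>\<pi>\<leftarrow>schedules ps. length \<pi> + 1)"
    by (simp add: length_concat comp_def)
  also have "\<dots> = (\<Sum>\<pi>\<leftarrow>schedules ps. length ps + 1)"
    by (intro arg_cong[of _ _ sum_list] map_cong) (auto dest: length_schedule)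
  finally show ?case using Cons by (simp add: sum_list_triv)
qed simp

definition solution :: "mrpt \<Rightarrow> int list list" where
  "solution x = (let \<pi>s = schedules (paths x)
    in labeling (paths x) (best [source x] (vertices x) (hd \<pi>s) \<pi>s))"

lemma best_in_set: "best R vs \<sigma> \<pi>s \<in> insert \<sigma> (set \<pi>s)"
  by (induction \<pi>s arbitrary: \<sigma>) auto

definition main_body :: expr where
  "main_body = (let ps = Right (Right (Var 0)) in
    Call 16 [ps, Call 12 [NodeE (Left (Var 0)) LeafE, Left (Right (Var 0)),
      Left (Call 7 [ps]), Call 7 [ps]]])"

text \<open>The \<open>let\<close> in \<open>main_body\<close> only duplicates expressions, and the
  schedules are computed twice; hence \<open>260 * N^4\<close>, twice the cost in
  \<open>calls_schedules\<close>.\<close>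

lemma calls_main:
  assumes N: "4 < N" and n: "nodes (enc_mrpt x) \<le> N"
    and S: "nodes (enc_list (enc_list (enc_list (enc_list enc_nat))) (schedules (paths x))) \<le> N"
    and \<pi>s: "\<And>\<pi>. \<pi> \<in> set (schedules (paths x)) \<Longrightarrow> small_schedule N enc_nat [source x] \<pi> \<and>
      5 + 2 * (\<Sum>\<sigma>\<leftarrow>\<pi>. length (hd \<sigma>)) \<le> N \<and>
      nodes (enc_list (enc_list enc_int) (labeling (paths x) \<pi>)) \<le> N"
  shows "calls (prog main_body) N 0 [enc_mrpt x] (enc_list (enc_list enc_int) (solution x))
    (170 * N^3 + 260 * N^4 + 480 * N^5 + 100)"
proof -
  define S where "S = schedules (paths x)"
  define b where "b = best [source x] (vertices x) (hd S) S"
  have hd: "hd S \<in> set S" by (simp add: S_def)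
  have b: "b \<in> set S" using best_in_set[of "[source x]" "vertices x" "hd S" S] hd
    by (auto simp: b_def)
  have sol: "solution x = labeling (paths x) b" by (simp add: solution_def b_def S_def Let_def)
  have ns: "nodes (enc_nat (source x)) + 2 \<le> N" "nodes (enc_list enc_nat (vertices x)) \<le> N"
    "nodes (enc_list (enc_list enc_nat) (paths x)) \<le> N"
    using n by (simp_all add: enc_mrpt_def)
  have "calls (prog main_body) N 7 [enc_list (enc_list enc_nat) (paths x)]
    (enc_list (enc_list (enc_list (enc_list enc_nat))) S) (130 * N^4)"
    unfolding S_def by (rule calls_schedules) (use N ns S in auto)
  note c7 = this
  have "calls (prog main_body) N 12 [enc_list enc_nat [source x], enc_list enc_nat (vertices x),
      enc_list (enc_list (enc_list enc_nat)) (hd S), enc_list (enc_list (enc_list (enc_list enc_nat))) S]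
    (enc_list (enc_list (enc_list enc_nat)) b) (480 * N^5)"
    unfolding b_def
    by (rule calls_best) (use N ns S \<pi>s hd inj_enc_nat in \<open>auto simp: S_def\<close>)
  note c12 = this[simplified]
  have "calls (prog main_body) N 16 [enc_list (enc_list enc_nat) (paths x),
      enc_list (enc_list (enc_list enc_nat)) b] (enc_list (enc_list enc_int) (solution x)) (170 * N^3)"
    unfolding sol
    by (rule calls_labeling)
      (use N ns \<pi>s[of b] b inj_enc_nat in \<open>auto simp: S_def small_schedule_def\<close>)
  note c16 = this
  have ne: "S \<noteq> []" by (simp add: S_def)
  have body: "prog main_body ! 0 =
    Call 16 [Right (Right (Var 0)), Call 12 [NodeE (Left (Var 0)) LeafE, Left (Right (Var 0)),
      Left (Call 7 [Right (Right (Var 0))]), Call 7 [Right (Right (Var 0))]]]"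
    by (simp only: prog_nth main_body_def Let_def)
  show ?thesis
    using N n ns ne
    apply (intro callsI[OF body])
    apply (unfold enc_mrpt_def)
    apply (rule wp_intros calls_wpc[OF c7] calls_wpc[OF c12] calls_wpc[OF c16] | simp)+
    done
qed

lemma nodes_enc_list_le:
  "(\<And>x. x \<in> set xs \<Longrightarrow> nodes (e x) \<le> B) \<Longrightarrow> nodes (enc_list e xs) \<le> 1 + length xs * (B + 1)"
proof (induction xs)
  case (Cons x xs)
  then have "nodes (e x) \<le> B" "nodes (enc_list e xs) \<le> 1 + length xs * (B + 1)" by auto
  then show ?case by simp
qed simp

lemma nodes_enc_mem: "x \<in> set xs \<Longrightarrow> nodes (e x) \<le> nodes (enc_list e xs)"
  by (induction xs) auto

lemma nodes_rides_le:
  "(\<And>\<tau>. \<tau> \<in> set \<pi> \<Longrightarrow> nodes (enc_list e (hd \<tau>)) \<le> n) \<Longrightarrow>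
    nodes (enc_list e (rides R \<pi>)) \<le> nodes (enc_list e R) + length \<pi> * n"
proof (induction \<pi> arbitrary: R)
  case (Cons \<tau> \<pi>)
  have "nodes (enc_list e (ride R (hd \<tau>))) \<le> n"
    using nodes_ride_le[of e R "hd \<tau>"] Cons.prems[of \<tau>] by simp
  then have "nodes (enc_list e (ride R (hd \<tau>) @ R)) \<le> nodes (enc_list e R) + n"
    using nodes_enc_list_append[of e "ride R (hd \<tau>)" R] by linarith
  then show ?case using Cons.IH[of "ride R (hd \<tau>) @ R"] Cons.prems by simp
qed simp

lemma nodes_block_le:
  "0 < t \<Longrightarrow> nodes (enc_list enc_int (block p t)) \<le>
    1 + length p * (nodes (enc_nat t) + 2 * length p + 3)"
proof (induction p t rule: block.induct)
  case (3 v w p t)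
  then have "nodes (enc_list enc_int (block (w # p) (2 * t))) \<le>
    1 + length (w # p) * (nodes (enc_nat t) + 2 * length (v # w # p) + 3)"
    by (simp add: enc_nat_double)
  then show ?case by (simp add: enc_int_of_nat)
qed auto

lemma nodes_labels_of_le:
  "0 < t \<Longrightarrow> (\<And>\<tau>. \<tau> \<in> set \<pi> \<Longrightarrow> length (hd \<tau>) \<le> n) \<Longrightarrow>
    nodes (enc_list enc_int (labels_of \<tau> \<pi> t)) \<le>
      1 + n * (nodes (enc_nat t) + 2 * (\<Sum>\<sigma>\<leftarrow>\<pi>. length (hd \<sigma>)) + 3)"
proof (induction \<pi> arbitrary: t)
  case (Cons \<sigma> \<pi>)
  show ?case
  proof (cases "\<tau> = \<sigma>")
    case True
    have "nodes (enc_list enc_int (labels_of \<tau> (\<sigma> # \<pi>) t)) \<le>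
      1 + length (hd \<sigma>) * (nodes (enc_nat t) + 2 * length (hd \<sigma>) + 3)"
      using nodes_block_le[OF Cons.prems(1), of "hd \<sigma>"] True by simp
    also have "\<dots> \<le> 1 + n * (nodes (enc_nat t) + 2 * (\<Sum>\<sigma>\<leftarrow>\<sigma> # \<pi>. length (hd \<sigma>)) + 3)"
      using Cons.prems(2)[of \<sigma>] by (intro add_left_mono mult_le_mono) auto
    finally show ?thesis .
  next
    case False
    then show ?thesis
      using Cons.IH[of "t * 2 ^ length (hd \<sigma>)"] Cons.prems
      by (simp add: nodes_enc_nat_shift add.assoc)
  qed
qed simp

lemma nodes_labeling_le:
  assumes "\<And>\<tau>. \<tau> \<in> set \<pi> \<Longrightarrow> length (hd \<tau>) \<le> n"
  shows "nodes (enc_list (enc_list enc_int) (labeling ps \<pi>)) \<le>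
      1 + length ps * (n * (2 * (\<Sum>\<sigma>\<leftarrow>\<pi>. length (hd \<sigma>)) + 8) + 2)"
proof (induction ps)
  case (Cons p ps)
  then show ?case
    using nodes_labels_of_le[of 1 \<pi> n "p # ps"] assms by (simp add: enc_nat_1 algebra_simps)
qed simp

lemma tails_cases:
  assumes "\<tau> \<in> set (tails ps)"
  shows "\<tau> \<noteq> []" "hd \<tau> \<in> set ps" "nodes (enc_list e \<tau>) \<le> nodes (enc_list e ps)"
  using assms by (induction ps) auto

text \<open>\<open>N\<close> covers the \<open>k!\<close> schedules, of size O(\<open>n * n\<close>)
  each, and the labeling: at most \<open>n\<close> paths with at most \<open>n\<close> labels of
  O(\<open>n * n\<close>) bits, whence the fourth power.\<close>

lemma runs_main:
  assumes "x \<in> mrpt_instances"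
  defines "n \<equiv> nodes (enc_mrpt x)"
  defines "N \<equiv> fact (length (paths x)) * (30 * (n + 1) ^ 4)"
  shows "\<exists>t \<le> 2000 * N^6. runs (prog main_body) (enc_mrpt x) (enc_list (enc_list enc_int) (solution x)) t"
proof -
  let ?k = "length (paths x)"
  have ps: "nodes (enc_list (enc_list enc_nat) (paths x)) \<le> n"
    and src: "nodes (enc_list enc_nat [source x]) \<le> n"
    by (simp_all add: n_def enc_mrpt_def)
  have k: "?k \<le> n" using length_less_nodes[of "paths x" "enc_list enc_nat"] ps by linarith
  have f: "1 \<le> (fact ?k :: nat)" by simp
  have N: "30 * (n + 1) ^ 4 \<le> N" unfolding N_def using mult_le_mono1[OF f, of "30 * (n + 1) ^ 4"] by simp
  have p4: "1 + n + n * n + n * n * n * n \<le> (n + 1) ^ 4"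
    by (simp add: power4_eq_xxxx algebra_simps)
  have \<pi>s: "nodes (enc_list (enc_list (enc_list enc_nat)) \<pi>) \<le> 1 + n * (n + 1)"
     "small_schedule N enc_nat [source x] \<pi> \<and>
      5 + 2 * (\<Sum>\<sigma>\<leftarrow>\<pi>. length (hd \<sigma>)) \<le> N \<and>
      nodes (enc_list (enc_list enc_int) (labeling (paths x) \<pi>)) \<le> N"
    if "\<pi> \<in> set (schedules (paths x))" for \<pi>
  proof -
    have s: "set \<pi> = set (tails (paths x))"
      using that by (metis set_schedules mset_eq_setD)
    have l: "length \<pi> \<le> n" using length_schedule[OF that] k by simp
    have "nodes (enc_list (enc_list (enc_list enc_nat)) \<pi>) \<le> 1 + length \<pi> * (n + 1)"
      using s ps by (intro nodes_enc_list_le) (auto dest: tails_cases(3)[of _ _ "enc_list enc_nat"])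
    also have "\<dots> \<le> 1 + n * (n + 1)" using l by (intro add_left_mono mult_le_mono1)
    finally show a: "nodes (enc_list (enc_list (enc_list enc_nat)) \<pi>) \<le> 1 + n * (n + 1)" .
    have hd: "nodes (enc_list enc_nat (hd \<tau>)) \<le> n" if "\<tau> \<in> set \<pi>" for \<tau>
      using nodes_enc_mem[of "hd \<tau>" "paths x" "enc_list enc_nat"] ps tails_cases(2)[of \<tau> "paths x"] that s
      by simp
    have lhd: "length (hd \<tau>) \<le> n" if "\<tau> \<in> set \<pi>" for \<tau>
      using length_less_nodes[of "hd \<tau>" enc_nat] hd[OF that] by linarith
    have "nodes (enc_list enc_nat (rides [source x] \<pi>)) \<le> n + length \<pi> * n"
      using nodes_rides_le[of \<pi> enc_nat n "[source x]", OF hd] src by linarith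
    also have "\<dots> \<le> n + n * n" using l by (intro add_left_mono mult_le_mono1)
    finally have r: "nodes (enc_list enc_nat (rides [source x] \<pi>)) \<le> n + n * n" .
    have "(\<Sum>\<sigma>\<leftarrow>\<pi>. length (hd \<sigma>)) \<le> length \<pi> * n"
      using lhd by (induction \<pi>) (auto intro: add_mono)
    also have "\<dots> \<le> n * n" using l by (rule mult_le_mono1)
    finally have sum: "(\<Sum>\<sigma>\<leftarrow>\<pi>. length (hd \<sigma>)) \<le> n * n" .
    have "nodes (enc_list (enc_list enc_int) (labeling (paths x) \<pi>)) \<le>
      1 + ?k * (n * (2 * (\<Sum>\<sigma>\<leftarrow>\<pi>. length (hd \<sigma>)) + 8) + 2)"
      by (rule nodes_labeling_le) (rule lhd)
    also have "\<dots> \<le> 1 + n * (n * (2 * (n * n) + 8) + 2)"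
      using k sum by (intro add_left_mono mult_le_mono add_right_mono) auto
    also have "\<dots> = 1 + 2 * n + 8 * (n * n) + 2 * (n * n * n * n)" by (simp add: algebra_simps)
    finally have lab: "nodes (enc_list (enc_list enc_int) (labeling (paths x) \<pi>)) \<le>
      1 + 2 * n + 8 * (n * n) + 2 * (n * n * n * n)" .
    have "1 + n * (n + 1) \<le> N" using N p4 by (simp only: distrib_left mult_1_right)
    moreover have "n + n * n \<le> N" "5 + 2 * (n * n) \<le> N" using N p4 by linarith+
    moreover have "1 + 2 * n + 8 * (n * n) + 2 * (n * n * n * n) \<le> N" using N p4 by linarith
    moreover have "[] \<notin> set \<pi>" using s tails_cases(1) by auto
    ultimately show "small_schedule N enc_nat [source x] \<pi> \<and>
      5 + 2 * (\<Sum>\<sigma>\<leftarrow>\<pi>. length (hd \<sigma>)) \<le> N \<and>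
      nodes (enc_list (enc_list enc_int) (labeling (paths x) \<pi>)) \<le> N"
      unfolding small_schedule_def using a r sum lab by linarith
  qed
  have "nodes (enc_list (enc_list (enc_list (enc_list enc_nat))) (schedules (paths x))) \<le>
    1 + fact ?k * (1 + n * (n + 1) + 1)"
    unfolding length_schedules[symmetric] by (rule nodes_enc_list_le) (rule \<pi>s(1))
  also have "\<dots> \<le> fact ?k * 1 + fact ?k * (1 + n * (n + 1) + 1)" using f by linarith
  also have "\<dots> = fact ?k * (3 + n + n * n)" by (simp add: algebra_simps)
  also have "\<dots> \<le> N" unfolding N_def
    by (rule mult_le_mono2) (use p4 in linarith)
  finally have S: "nodes (enc_list (enc_list (enc_list (enc_list enc_nat))) (schedules (paths x))) \<le> N" .
  have N4: "4 < N" and nN: "nodes (enc_mrpt x) \<le> N" using N p4 unfolding n_def[symmetric] by linarith+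
  from calls_runs[OF calls_main[OF N4 nN S \<pi>s(2)] _ nN]
  obtain t where t: "t \<le> (170 * N^3 + 260 * N^4 + 480 * N^5 + 100 + 2) * N"
    "runs (prog main_body) (enc_mrpt x) (enc_list (enc_list enc_int) (solution x)) t"
    by auto
  have "N^3 \<le> N^5" "N^4 \<le> N^5" "1 \<le> N^5"
    using N4 power_increasing[of 3 5 N] power_increasing[of 4 5 N] by simp_all
  then have "(170 * N^3 + 260 * N^4 + 480 * N^5 + 100 + 2) * N \<le> (2000 * N^5) * N"
    by (intro mult_le_mono1) linarith
  also have "\<dots> = 2000 * N^6" by (simp add: power_numeral_reduce)
  finally show ?thesis using t by (meson le_trans)
qed

section \<open>Serial labelings are optimal\<close>

lemma subset_rides: "set R \<subseteq> set (rides R \<pi>)"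
proof (induction \<pi> arbitrary: R)
  case (Cons \<tau> \<pi>)
  show ?case using Cons.IH[of "ride R (hd \<tau>) @ R"] by simp
qed simp

lemma rides_append: "rides R (\<pi> @ \<rho>) = rides (rides R \<pi>) \<rho>"
  by (induction \<pi> arbitrary: R) auto

text \<open>\<open>dropWhile\<close> stops at position \<open>b\<close> at the latest, so every
  position from \<open>b\<close> on survives. Boarding at the first known vertex thus loses
  nothing.\<close>

lemma nth_in_ride:
  assumes "p ! b \<in> set R" "b \<le> j" "j < length p"
  shows "p ! j \<in> set (ride R p)"
  using assms
proof (induction p arbitrary: b j)
  case (Cons v p)
  show ?case
  proof (cases "v \<in> set R")
    case True
    then show ?thesis using Cons.prems by (simp add: nth_mem[of j "v # p", simplified])
  next
    case False
    then obtain b' where "b = Suc b'" using Cons.prems(1) by (cases b) auto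
    moreover obtain j' where "j = Suc j'" using Cons.prems(2) calculation by (cases j) auto
    ultimately show ?thesis using Cons False by auto
  qed
qed simp

text \<open>Stated with positions because a path may visit a vertex repeatedly.\<close>

lemma set_ride_nth:
  assumes "v \<in> set (ride R p)"
  obtains b j where "b \<le> j" "j < length p" "p ! b \<in> set R" "p ! j = v"
  using assms
proof (induction p arbitrary: thesis)
  case (Cons w p)
  show ?case
  proof (cases "w \<in> set R")
    case True
    then obtain j where "j < length (w # p)" "(w # p) ! j = v"
      using Cons.prems(2) by (metis in_set_conv_nth ride_simps(2))
    then show ?thesis using Cons.prems(1)[of 0 j] True by simp
  next
    case False
    then obtain b j where "b \<le> j" "j < length p" "p ! b \<in> set R" "p ! j = v"
      using Cons.IH Cons.prems(2) by auto
    then show ?thesis using Cons.prems(1)[of "Suc b" "Suc j"] by simp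
  qed
qed simp

lemma length_block: "p \<noteq> [] \<Longrightarrow> length (block p t) + 1 = length p"
  by (induction p t rule: block.induct) auto

lemma block_nth: "j + 1 < length p \<Longrightarrow> block p t ! j = int (t * 2 ^ j)"
proof (induction p t arbitrary: j rule: block.induct)
  case (3 v w p t)
  then show ?case by (cases j) auto
qed auto

lemma sorted_block: "0 < t \<Longrightarrow> sorted_wrt (<) (block p t)"
proof (cases "p = []")
  case False
  assume "0 < t"
  then show ?thesis using length_block[OF False, of t]
    by (auto simp: sorted_wrt_iff_nth_less block_nth)
qed simp

text \<open>The first label available after the paths of \<open>\<pi>\<close>, when labeling starts
  at 1.\<close>

definition finish :: "'a list list list \<Rightarrow> nat" where
  "finish \<pi> = 2 ^ (\<Sum>\<sigma>\<leftarrow>\<pi>. length (hd \<sigma>))"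

lemma labels_of_append:
  "\<tau> \<notin> set \<pi> \<Longrightarrow> labels_of \<tau> (\<pi> @ \<tau> # \<rho>) t = block (hd \<tau>) (t * finish \<pi>)"
  by (induction \<pi> arbitrary: t) (auto simp: finish_def power_add mult.assoc)

lemma length_labeling [simp]: "length (labeling ps \<pi>) = length ps"
  by (induction ps) auto

lemma labeling_nth: "i < length ps \<Longrightarrow> labeling ps \<pi> ! i = labels_of (drop i ps) \<pi> 1"
proof (induction ps arbitrary: i)
  case (Cons p ps)
  then show ?case by (cases i) auto
qed simp

lemma temporal_path_Nil: "u \<in> set (vertices x) \<Longrightarrow> temporal_path (temporalization x L) u [] u"
  by (simp add: temporal_path_def temporalization_def pre_digraph.awalk_def pre_digraph.cas.simps)

text \<open>The arguments below extend and inspect temporal paths at their last edge, whereas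
  \<open>cas\<close> recurses at the first one.\<close>

lemma temporal_path_snoc:
  "temporal_path (temporalization x L) u (q @ [((i, j), t)]) v \<longleftrightarrow>
    temporal_path (temporalization x L) u q (paths x ! i ! j) \<and>
    i < length (paths x) \<and> j + 1 < length (paths x ! i) \<and> t = L ! i ! j \<and>
    paths x ! i ! (j + 1) = v \<and> (\<forall>s\<in>set (map snd q). s < t)"
proof -
  have c: "pre_digraph.cas G u (es @ [e]) v \<longleftrightarrow> pre_digraph.cas G u es (tail G e) \<and> head G e = v"
    for G :: "(nat, nat \<times> nat) pre_digraph" and u es e v
    by (induction es arbitrary: u) (auto simp: pre_digraph.cas.simps)
  show ?thesis
    by (auto simp: temporal_path_def temporalization_def pre_digraph.awalk_def c sorted_wrt_append)
qed

lemma reached_subset: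
  assumes "x \<in> mrpt_instances"
  shows "reached (temporalization x L) u \<subseteq> set (vertices x)"
proof -
  interpret wf_digraph "underlying (temporalization x L)" by (rule wf_temporalization[OF assms])
  have "verts (underlying (temporalization x L)) = set (vertices x)"
    by (simp add: temporalization_def)
  then show ?thesis by (auto simp: reached_def temporal_path_def dest!: awalk_last_in_verts)
qed

lemma distinct_tails: "distinct (tails ps)"
  by (auto simp: tails_def distinct_map inj_on_def dest: arg_cong[of _ _ length])

lemma drop_in_tails: "i < length ps \<Longrightarrow> drop i ps \<in> set (tails ps)"
  by (auto simp: tails_def)

text \<open>\<open>labels_of\<close> stops at the first match; as all suffixes are distinct, nothing
  in \<open>\<rho>\<close> matches.\<close>

lemma labeling_nth_block:
  assumes "mset (\<rho> @ drop i ps # \<sigma>) = mset (tails ps)" "i < length ps"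
  shows "labeling ps (\<rho> @ drop i ps # \<sigma>) ! i = block (ps ! i) (finish \<rho>)"
proof -
  have "distinct (\<rho> @ drop i ps # \<sigma>)" using assms(1) distinct_tails mset_eq_imp_distinct_iff by blast
  then show ?thesis using assms(2) by (simp add: labeling_nth labels_of_append hd_drop_conv_nth)
qed

lemma finish_pos [simp]: "0 < finish \<pi>"
  by (simp add: finish_def)

lemma path_labeling_labeling:
  assumes "x \<in> mrpt_instances" "mset \<pi> = mset (tails (paths x))"
  shows "path_labeling x (labeling (paths x) \<pi>)"
  unfolding path_labeling_def
proof (intro conjI allI impI)
  fix i assume i: "i < length (paths x)"
  then have "drop i (paths x) \<in> set \<pi>" using drop_in_tails assms(2) mset_eq_setD by metis
  then obtain \<rho> \<sigma> where "\<pi> = \<rho> @ drop i (paths x) # \<sigma>" by (meson split_list)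
  then have e: "labeling (paths x) \<pi> ! i = block (paths x ! i) (finish \<rho>)"
    using labeling_nth_block assms(2) i by blast
  have "paths x ! i \<noteq> []" using assms(1) i by (auto simp: mrpt_instances_def)
  then show "length (labeling (paths x) \<pi> ! i) + 1 = length (paths x ! i)"
    unfolding e by (rule length_block)
  show "sorted_wrt (<) (labeling (paths x) \<pi> ! i)" unfolding e by (rule sorted_block) simp
qed simp

text \<open>The deadline \<open>finish \<rho>\<close> carries the induction, since the next block
  starts exactly there. \<open>\<sigma>\<close> varies so that the schedule as a whole, and with it
  the labeling, stays fixed while paths move between \<open>\<rho>\<close> and
  \<open>\<sigma>\<close>.\<close>

lemma rides_reached:
  assumes x: "x \<in> mrpt_instances" and \<pi>: "mset (\<rho> @ \<sigma>) = mset (tails (paths x))"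
    and v: "v \<in> set (rides [source x] \<rho>)"
  defines "G \<equiv> temporalization x (labeling (paths x) (\<rho> @ \<sigma>))"
  shows "\<exists>q. temporal_path G (source x) q v \<and> (\<forall>t\<in>set (map snd q). t < int (finish \<rho>))"
  unfolding G_def using \<pi> v
proof (induction \<rho> arbitrary: v \<sigma> rule: rev_induct)
  case Nil
  then have "v = source x" "source x \<in> set (vertices x)" using x by (auto simp: mrpt_instances_def)
  then show ?case by (intro exI[of _ "[]"]) (simp add: temporal_path_Nil)
next
  case (snoc \<tau> \<rho>)
  let ?L = "labeling (paths x) (\<rho> @ \<tau> # \<sigma>)"
  let ?G = "temporalization x ?L" and ?R = "rides [source x] \<rho>"
  have IH: "\<exists>q. temporal_path ?G (source x) q w \<and> (\<forall>t\<in>set (map snd q). t < int (finish \<rho>))"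
    if "w \<in> set ?R" for w
    using snoc.IH[of "\<tau> # \<sigma>" w] snoc.prems(1) that by simp
  have "\<tau> \<in> set (tails (paths x))"
    using mset_eq_setD[OF snoc.prems(1)] by auto
  then obtain i where i: "i < length (paths x)" "\<tau> = drop i (paths x)" by (auto simp: tails_def)
  let ?p = "paths x ! i"
  have hd: "hd \<tau> = ?p" using i by (simp add: hd_drop_conv_nth)
  have L: "?L ! i ! j = int (finish \<rho> * 2 ^ j)" if "j + 1 < length ?p" for j
    using labeling_nth_block[of \<rho> i "paths x" \<sigma>] snoc.prems(1) i that by (simp add: block_nth)
  have fin: "finish (\<rho> @ [\<tau>]) = finish \<rho> * 2 ^ length ?p"
    by (simp add: finish_def power_add hd)
  \<comment> \<open>Inner induction along the ridden path: the deadline at position \<open>j\<close>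
    is the label of edge \<open>j\<close>, if there is one, so that edge can be appended.\<close>
  have ride: "\<exists>q. temporal_path ?G (source x) q (?p ! j) \<and>
      (\<forall>t\<in>set (map snd q). t < int (finish \<rho> * 2 ^ j))"
    if b: "?p ! b \<in> set ?R" and "b \<le> j" "j < length ?p" for b j
    using that(2,3)
  proof (induction j rule: dec_induct)
    case base
    obtain q where q: "temporal_path ?G (source x) q (?p ! b)"
      "\<forall>t\<in>set (map snd q). t < int (finish \<rho>)" using IH[OF b] by blast
    have "int (finish \<rho>) \<le> int (finish \<rho> * 2 ^ b)" by simp
    then show ?case using q by (meson order_less_le_trans)
  next
    case (step j)
    then obtain q where q: "temporal_path ?G (source x) q (?p ! j)"
      "\<forall>t\<in>set (map snd q). t < int (finish \<rho> * 2 ^ j)" by auto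
    have j: "j + 1 < length ?p" using step by simp
    have "temporal_path ?G (source x) (q @ [((i, j), ?L ! i ! j)]) (?p ! Suc j)"
      using q i(1) j L[OF j] by (simp add: temporal_path_snoc)
    moreover have "int (finish \<rho> * 2 ^ j) < int (finish \<rho> * 2 ^ Suc j)" by simp
    then have "\<forall>t\<in>set (map snd (q @ [((i, j), ?L ! i ! j)])). t < int (finish \<rho> * 2 ^ Suc j)"
      using q(2) L[OF j] by (auto intro: order_less_trans simp del: of_nat_mult)
    ultimately show ?case by blast
  qed
  show ?case
  proof (cases "v \<in> set ?R")
    case True
    then obtain q where "temporal_path ?G (source x) q v" "\<forall>t\<in>set (map snd q). t < int (finish \<rho>)"
      using IH by blast
    moreover have "int (finish \<rho>) \<le> int (finish (\<rho> @ [\<tau>]))" by (simp add: fin)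
    ultimately show ?thesis by (simp only: append_assoc append.simps) (meson order_less_le_trans)
  next
    case False
    then have "v \<in> set (ride ?R ?p)" using snoc.prems(2) by (simp add: rides_append hd)
    then obtain b j where bj: "b \<le> j" "j < length ?p" "?p ! b \<in> set ?R" "?p ! j = v"
      by (rule set_ride_nth)
    then obtain q where "temporal_path ?G (source x) q v"
      "\<forall>t\<in>set (map snd q). t < int (finish \<rho> * 2 ^ j)" using ride[OF bj(3,1,2)] by blast
    moreover have "int (finish \<rho> * 2 ^ j) \<le> int (finish (\<rho> @ [\<tau>]))"
      using bj(2) by (simp add: fin)
    ultimately show ?thesis by (simp only: append_assoc append.simps) (meson order_less_le_trans)
  qed
qed

lemma reached_subset_rides:
  assumes L: "path_labeling x L"
  shows "\<exists>\<pi>. mset \<pi> = mset (tails (paths x)) \<and>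
    reached (temporalization x L) (source x) \<subseteq> set (rides [source x] \<pi>)"
proof -
  let ?G = "temporalization x L" and ?ps = "paths x" and ?s = "source x"
  define usable where "usable i j \<longleftrightarrow> i < length ?ps \<and> j + 1 < length (?ps ! i) \<and>
    (\<exists>q. temporal_path ?G ?s q (?ps ! i ! j) \<and> (\<forall>t\<in>set (map snd q). t < L ! i ! j))" for i j
  \<comment> \<open>Unspecified if path \<open>i\<close> has no usable edge. Such a path may stand
    anywhere in the order, because \<open>claim\<close> speaks of usable edges only.\<close>
  define board where "board i = (LEAST j. usable i j)" for i
  define key where "key i = L ! i ! board i" for i
  define ix where "ix = sort_key key [0..<length ?ps]"
  define d where "d i = drop i ?ps" for i
  have set_ix: "set ix = {..<length ?ps}" by (auto simp: ix_def)
  have board: "usable i (board i)" "board i \<le> j" if "usable i j" for i j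
    using that unfolding board_def by (auto intro: LeastI Least_le)
  \<comment> \<open>Labels increase along a path, so the first usable edge has the smallest label
    among the usable ones.\<close>
  have key: "key i \<le> L ! i ! j" if u: "usable i j" for i j
  proof (cases "board i = j")
    case False
    then have "board i < j" "j < length (L ! i)" "sorted_wrt (<) (L ! i)"
      using board(2)[OF u] u L by (fastforce simp: usable_def path_labeling_def)+
    then show ?thesis unfolding key_def by (simp add: sorted_wrt_nth_less less_imp_le)
  qed (simp add: key_def)
  \<comment> \<open>Strong induction on the position in \<open>ix\<close>, since the path on which
    the traveller arrives may stand anywhere before \<open>i\<close>.\<close>
  have claim: "?ps ! i ! (j + 1) \<in> set (rides [?s] (map d (as @ [i])))"
    if "ix = as @ i # bs" "usable i j" for as i bs j
    using that
  proof (induction "length as" arbitrary: as i bs j rule: less_induct)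
    case less
    let ?R = "rides [?s] (map d as)"
    have ub: "usable i (board i)" and bj: "board i \<le> j" using board less.prems(2) by auto
    obtain q where q: "temporal_path ?G ?s q (?ps ! i ! board i)"
      "\<forall>t\<in>set (map snd q). t < key i"
      using ub unfolding usable_def key_def by blast
    have "?ps ! i ! board i \<in> set ?R"
    proof (cases q rule: rev_cases)
      case Nil
      then have "?ps ! i ! board i = ?s"
        using q(1) by (simp add: temporal_path_def pre_digraph.awalk_def pre_digraph.cas.simps)
      then show ?thesis using subset_rides[of "[?s]" "map d as"] by auto
    next
      case (snoc q' a)
      obtain i' c t where a: "a = ((i', c), t)" by (metis prod.exhaust)
      \<comment> \<open>The edge of arrival is usable itself, so its label is at least
        \<open>key i'\<close>; since the label is also below \<open>key i\<close>, the keys differ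
        strictly, and ties in the sorting do no harm.\<close>
      have u': "usable i' c" and t: "t = L ! i' ! c" and e: "?ps ! i' ! (c + 1) = ?ps ! i ! board i"
        using q(1) unfolding snoc a temporal_path_snoc usable_def by auto
      have "t < key i" using q(2) snoc a by simp
      then have "key i' < key i" using key[OF u'] t by simp
      moreover have "\<forall>i'\<in>set (i # bs). key i \<le> key i'"
        using sorted_sort_key[of key "[0..<length ?ps]"] less.prems(1)
        by (auto simp: ix_def[symmetric] sorted_append)
      moreover have "i' \<in> set ix" using u' set_ix by (simp add: usable_def)
      ultimately have "i' \<in> set as" using less.prems(1) by (auto simp: not_le[symmetric])
      then obtain as1 as2 where as: "as = as1 @ i' # as2" by (meson split_list)
      then have "?ps ! i' ! (c + 1) \<in> set (rides [?s] (map d (as1 @ [i'])))"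
        using less.hyps[of as1 i' "as2 @ i # bs" c] less.prems(1) u' by simp
      moreover have "?R = rides (rides [?s] (map d (as1 @ [i']))) (map d as2)"
        by (simp add: as rides_append)
      ultimately show ?thesis using e subset_rides by (metis subsetD)
    qed
    then have "?ps ! i ! (j + 1) \<in> set (ride ?R (?ps ! i))"
      using bj less.prems(2) by (intro nth_in_ride[of _ "board i"]) (auto simp: usable_def)
    moreover have "hd (d i) = ?ps ! i"
      using less.prems(2) by (simp add: d_def hd_drop_conv_nth usable_def)
    ultimately show ?case by (simp add: rides_append)
  qed
  have "v \<in> set (rides [?s] (map d ix))" if v: "v \<in> reached ?G ?s" for v
  proof -
    obtain q where q: "temporal_path ?G ?s q v" using v by (auto simp: reached_def)
    show ?thesis
    proof (cases q rule: rev_cases)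
      case Nil
      then have "v = ?s"
        using q by (simp add: temporal_path_def pre_digraph.awalk_def pre_digraph.cas.simps)
      then show ?thesis using subset_rides[of "[?s]" "map d ix"] by auto
    next
      case (snoc q' a)
      obtain i j t where a: "a = ((i, j), t)" by (metis prod.exhaust)
      have u: "usable i j" and e: "?ps ! i ! (j + 1) = v"
        using q unfolding snoc a temporal_path_snoc usable_def by auto
      then have "i \<in> set ix" using set_ix by (simp add: usable_def)
      then obtain as bs where ix: "ix = as @ i # bs" by (meson split_list)
      have "rides [?s] (map d ix) = rides (rides [?s] (map d (as @ [i]))) (map d bs)"
        by (simp add: ix rides_append)
      then show ?thesis
        using claim[OF ix u] e subset_rides[of "rides [?s] (map d (as @ [i]))" "map d bs"]
        by auto
    qed
  qed
  moreover have "mset (map d ix) = mset (tails ?ps)"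
    by (simp add: ix_def tails_def d_def[abs_def])
  ultimately show ?thesis by blast
qed

lemma score_le_best: "\<pi> \<in> insert \<sigma> (set \<pi>s) \<Longrightarrow> score R vs \<pi> \<le> score R vs (best R vs \<sigma> \<pi>s)"
proof (induction \<pi>s arbitrary: \<sigma> \<pi>)
  case (Cons \<rho> \<pi>s)
  have "score R vs \<sigma> \<le> score R vs (best R vs \<sigma> \<pi>s)" "score R vs \<rho> \<le> score R vs (best R vs \<rho> \<pi>s)"
    using Cons.IH by auto
  moreover have "score R vs \<pi> \<le> score R vs (best R vs \<sigma> \<pi>s)"
    "score R vs \<pi> \<le> score R vs (best R vs \<rho> \<pi>s)" if "\<pi> \<in> set \<pi>s"
    using Cons.IH that by auto
  ultimately show ?case using Cons.prems by auto
qed simp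

lemma score_eq_card: "distinct vs \<Longrightarrow> score R vs \<pi> = card (set (rides R \<pi>) \<inter> set vs)"
  unfolding score_def by (subst distinct_card[symmetric]) (auto intro: arg_cong[of _ _ card])

lemma optimal_solution:
  assumes x: "x \<in> mrpt_instances"
  shows "optimal_labeling x (solution x)"
proof -
  let ?S = "schedules (paths x)" and ?s = "source x" and ?vs = "vertices x"
  define b where "b = best [?s] ?vs (hd ?S) ?S"
  have "b \<in> set ?S" using best_in_set[of "[?s]" ?vs "hd ?S" ?S] by (auto simp: b_def)
  then have b: "mset b = mset (tails (paths x))" by (simp add: set_schedules)
  have sol: "solution x = labeling (paths x) b" by (simp add: solution_def b_def Let_def)
  have d: "distinct ?vs" using x by (simp add: mrpt_instances_def)
  have "set (rides [?s] b) \<subseteq> reached (temporalization x (solution x)) ?s"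
    using rides_reached[OF x, of b "[]"] b by (auto simp: sol reached_def)
  then have le: "score [?s] ?vs b \<le> card (reached (temporalization x (solution x)) ?s)"
    unfolding score_eq_card[OF d]
    by (intro card_mono finite_subset[OF reached_subset[OF x]]) auto
  show ?thesis
    unfolding optimal_labeling_def
  proof (intro conjI allI impI)
    show "path_labeling x (solution x)" unfolding sol by (rule path_labeling_labeling[OF x b])
    fix L' assume "path_labeling x L'"
    then obtain \<pi> where \<pi>: "mset \<pi> = mset (tails (paths x))"
      "reached (temporalization x L') ?s \<subseteq> set (rides [?s] \<pi>)"
      using reached_subset_rides by blast
    have "card (reached (temporalization x L') ?s) \<le> score [?s] ?vs \<pi>"
      unfolding score_eq_card[OF d] using \<pi>(2) reached_subset[OF x] by (intro card_mono) auto
    also have "\<dots> \<le> score [?s] ?vs b"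
      using score_le_best[of \<pi> "hd ?S" ?S] \<pi>(1) by (simp add: b_def set_schedules)
    finally show "card (reached (temporalization x L') ?s)
      \<le> card (reached (temporalization x (solution x)) ?s)" using le by simp
  qed
qed

theorem theorem15:
  shows "fixed_parameter_tractable mrpt_instances (\<lambda>x. length (paths x)) optimal_labeling
    enc_mrpt (enc_list (enc_list enc_int))"
proof -
  \<comment> \<open>The bound of \<open>runs_main\<close> without its factor \<open>(k!)^6\<close>,
    which goes into \<open>tower\<close>.\<close>
  define p :: "nat poly" where "p = [:2000:] * ([:30:] * [:1, 1:] ^ 4) ^ 6"
  have p: "poly p n = 2000 * (30 * (n + 1) ^ 4) ^ 6" for n
    by (simp add: p_def poly_power)
  have "\<exists>t. runs (prog main_body) (enc_mrpt x) (enc_list (enc_list enc_int) (solution x)) t \<and>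
      t \<le> tower (length (paths x)) * poly p (nodes (enc_mrpt x))"
    if x: "x \<in> mrpt_instances" for x
  proof -
    let ?q = "30 * (nodes (enc_mrpt x) + 1) ^ 4"
    obtain t where t: "t \<le> 2000 * (fact (length (paths x)) * ?q) ^ 6"
      "runs (prog main_body) (enc_mrpt x) (enc_list (enc_list enc_int) (solution x)) t"
      using runs_main[OF x] by blast
    have "2000 * (fact (length (paths x)) * ?q) ^ 6 = fact (length (paths x)) ^ 6 * (2000 * ?q ^ 6)"
      by (simp only: power_mult_distrib mult_ac)
    also have "\<dots> \<le> tower (length (paths x)) * (2000 * ?q ^ 6)"
      by (intro mult_le_mono1 fact_power_le_tower)
    finally show ?thesis using t unfolding p by (meson le_trans)
  qed
  then show ?thesis
    unfolding fixed_parameter_tractable_def using computable_tower optimal_solution by blast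
qed

end
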